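(* Let $\Omega \subset \mathbb{C}^n$ be a Reinhardt domain, and suppose that $F:\Omega\to\mathbb{R}$ is upper semicontinuous, torically uniformly continuous on $\Omega$, and bounded from below. Then the Perron–Bremermann envelope $$P(F) := \sup\{u(z) : u \in \mathcal{PSH}(\Omega),\ u^* \le F\}$$ is continuous on $\Omega$.
   Context: $\mathcal{PSH}(\Omega)$ denotes the plurisubharmonic functions on $\Omega$, and $u^*$ is the upper semicontinuous regularization of $u$ (equal to $u$ on $\Omega$ for plurisubharmonic $u$). A Reinhardt domain is a domain invariant under the toric action $(z_1,\dots,z_n)\mapsto(e^{i\theta_1}z_1,\dots,e^{i\theta_n}z_n)$, $\theta_j\in\mathbb{R}$. For a set $A\subset\mathbb{C}^n$ invariant under the toric action, a function $F:A\to\mathbb{R}$ is torically uniformly continuous if the family $\{F_z : z\in A\}$ is equicontinuous, where $F_z: S^1\times\cdots\times S^1\to\mathbb{R}$, $F_z(e^{i\theta_1},\dots,e^{i\theta_n}) = F(e^{i\theta_1}z_1,\dots,e^{i\theta_n}z_n)$. *)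

theory Defs
  imports "HOL-Analysis.Analysis"
begin

(* C^n is complex ^ 'n with n = CARD('n).  A function on a set S is a total function of which only
   the values on S matter. *)

definition usc_on :: "'a::topological_space set \<Rightarrow> ('a \<Rightarrow> 'b::linorder) \<Rightarrow> bool" where
  "usc_on S f \<longleftrightarrow> (\<forall>x\<in>S. \<forall>y>f x. eventually (\<lambda>w. f w < y) (at x within S))"

(* The limsup is over points of S tending to x, with x itself included when x is in S. *)
definition usc_reg :: "'a::topological_space set \<Rightarrow> ('a \<Rightarrow> ereal) \<Rightarrow> 'a \<Rightarrow> ereal" where
  "usc_reg S u x = Limsup (inf (nhds x) (principal S)) u"

(* The mean of v over the circle |w - c| = r.  The integral is the difference of the integrals of
   the positive and the negative part (e2ennreal sends negative values to 0).  For v upper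
   semicontinuous with values < infinity the first one is finite, so that infinity - infinity does
   not occur, and the mean may be -infinity. *)
definition circle_mean :: "(complex \<Rightarrow> ereal) \<Rightarrow> complex \<Rightarrow> real \<Rightarrow> ereal" where
  "circle_mean v c r =
     (enn2ereal (\<integral>\<^sup>+t\<in>{0..2*pi}. e2ennreal (v (c + of_real r * cis t)) \<partial>lborel)
      - enn2ereal (\<integral>\<^sup>+t\<in>{0..2*pi}. e2ennreal (- v (c + of_real r * cis t)) \<partial>lborel))
     / ereal (2 * pi)"

(* The function that is identically -infinity is admitted as (pluri)subharmonic. *)
definition subharmonic_on :: "complex set \<Rightarrow> (complex \<Rightarrow> ereal) \<Rightarrow> bool" where
  "subharmonic_on D v \<longleftrightarrow>
     usc_on D v \<and> (\<forall>w\<in>D. v w < \<infinity>) \<and>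
     (\<forall>c r. 0 < r \<and> cball c r \<subseteq> D \<longrightarrow> v c \<le> circle_mean v c r)"

definition psh_on :: "(complex ^ 'n) set \<Rightarrow> (complex ^ 'n \<Rightarrow> ereal) \<Rightarrow> bool" where
  "psh_on \<Omega> u \<longleftrightarrow>
     usc_on \<Omega> u \<and> (\<forall>z\<in>\<Omega>. u z < \<infinity>) \<and>
     (\<forall>a b. subharmonic_on {w. a + w *s b \<in> \<Omega>} (\<lambda>w. u (a + w *s b)))"

definition torus :: "(complex ^ 'n) set" where
  "torus = {\<tau>. \<forall>j. norm (\<tau> $ j) = 1}"

definition toric_act :: "complex ^ 'n \<Rightarrow> complex ^ 'n \<Rightarrow> complex ^ 'n" where
  "toric_act \<tau> z = (\<chi> j. \<tau> $ j * z $ j)"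

definition toric_invariant :: "(complex ^ 'n) set \<Rightarrow> bool" where
  "toric_invariant A \<longleftrightarrow> (\<forall>\<tau>\<in>torus. \<forall>z\<in>A. toric_act \<tau> z \<in> A)"

definition Reinhardt_domain :: "(complex ^ 'n) set \<Rightarrow> bool" where
  "Reinhardt_domain \<Omega> \<longleftrightarrow> open \<Omega> \<and> connected \<Omega> \<and> \<Omega> \<noteq> {} \<and> toric_invariant \<Omega>"

definition equicontinuous_on ::
    "'a::metric_space set \<Rightarrow> ('a \<Rightarrow> 'b::metric_space) set \<Rightarrow> bool" where
  "equicontinuous_on T \<F> \<longleftrightarrow>
     (\<forall>x\<in>T. \<forall>\<epsilon>>0. \<exists>\<delta>>0. \<forall>f\<in>\<F>. \<forall>y\<in>T. dist y x < \<delta> \<longrightarrow> dist (f y) (f x) < \<epsilon>)"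

definition torically_uniformly_continuous_on ::
    "(complex ^ 'n) set \<Rightarrow> (complex ^ 'n \<Rightarrow> real) \<Rightarrow> bool" where
  "torically_uniformly_continuous_on A F \<longleftrightarrow>
     equicontinuous_on torus ((\<lambda>z \<tau>. F (toric_act \<tau> z)) ` A)"

(* The supremum is taken in the extended reals; for F bounded from below on \<Omega> it is finite on
   \<Omega>, see PB_envelope_finite. *)
definition PB_envelope ::
    "(complex ^ 'n) set \<Rightarrow> (complex ^ 'n \<Rightarrow> real) \<Rightarrow> complex ^ 'n \<Rightarrow> ereal" where
  "PB_envelope \<Omega> F z =
     Sup {u z | u. psh_on \<Omega> u \<and> (\<forall>w\<in>\<Omega>. usc_reg \<Omega> u w \<le> ereal (F w))}"

lemma usc_reg_ge:
  fixes u :: "'a::topological_space \<Rightarrow> ereal"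
  assumes "x \<in> S"
  shows "u x \<le> usc_reg S u x"
  unfolding usc_reg_def Limsup_def
proof (rule INF_greatest)
  fix P assume "P \<in> {P. eventually P (inf (nhds x) (principal S))}"
  then have "P x"
    using assms by (auto simp: eventually_inf_principal dest: eventually_nhds_x_imp_x)
  then show "u x \<le> Sup (u ` Collect P)" by (auto intro: SUP_upper)
qed

lemma circle_mean_const:
  "circle_mean (\<lambda>_. ereal c) a r = ereal c"
proof -
  have "(\<integral>\<^sup>+t\<in>{0..2*pi}. e2ennreal (ereal x) \<partial>lborel) = ennreal (max 0 x * (2 * pi))" for x
    by (subst nn_integral_cmult_indicator) (auto simp: ennreal_mult' e2ennreal_ereal max_def ennreal_neg)
  from this[of c] this[of "- c"] show ?thesis
    by (simp add: circle_mean_def enn2ereal_ennreal max_def)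
qed

lemma PB_envelope_finite:
  assumes "bdd_below (F ` \<Omega>)" and "z \<in> \<Omega>"
  shows "\<bar>PB_envelope \<Omega> F z\<bar> \<noteq> \<infinity>"
proof -
  obtain c where c: "\<And>w. w \<in> \<Omega> \<Longrightarrow> c \<le> F w"
    using assms(1) by (auto simp: bdd_below_def)
  have "psh_on \<Omega> (\<lambda>_. ereal c)"
    by (auto simp: psh_on_def subharmonic_on_def usc_on_def circle_mean_const)
  moreover have "usc_reg \<Omega> (\<lambda>_. ereal c) w \<le> ereal (F w)" if "w \<in> \<Omega>" for w
  proof -
    have "usc_reg \<Omega> (\<lambda>_. ereal c) w \<le> ereal c"
      unfolding usc_reg_def by (rule Limsup_bounded) simp
    with c[OF that] show ?thesis by (meson ereal_less_eq(3) order_trans)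
  qed
  ultimately have "ereal c \<le> PB_envelope \<Omega> F z"
    unfolding PB_envelope_def by (intro Sup_upper) auto
  moreover have "PB_envelope \<Omega> F z \<le> ereal (F z)"
    unfolding PB_envelope_def
    by (rule Sup_least) (use assms(2) in \<open>auto intro: order_trans[OF usc_reg_ge]\<close>)
  ultimately show ?thesis by auto
qed

end

(* The envelope P is bounded from below by inf F.  Its upper semicontinuous regularization is
   plurisubharmonic and still lies below F because F is upper semicontinuous; hence it is a
   competitor and P is upper semicontinuous and plurisubharmonic.  If F(tau z) and F(z) differ by less
   than eps for all z, then P(tau z) - eps is again a competitor, so P inherits the toric modulus of
   continuity of F.

   What remains is lower semicontinuity at a point a, proved one coordinate at a time.  If a_j = 0,
   a value P(w) well below P(a) forces P to be small on an arc of fixed angular length of the circle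
   |zeta| = |w_j|; as P <= P(a) + eps' near a, this contradicts the mean value inequality at the
   centre 0.  If a_j is not 0, a value P(w) well below P(a) forces P to be small on an arc of fixed
   length through w_j; seen from a_j, which is very close to that arc, the arc has almost full harmonic
   measure, and a quadratic superharmonic barrier makes this quantitative. *)
theory Submission
  imports Defs
begin

section \<open>Upper semicontinuous functions\<close>

text \<open>The punctured neighbourhood of the definition can be filled in because the bound holds
  at \<open>x\<close> itself.\<close>

lemma usc_on_iff_open:
  fixes f :: "'a::topological_space \<Rightarrow> 'b::linorder"
  shows "usc_on S f \<longleftrightarrow> (\<forall>x\<in>S. \<forall>y>f x. \<exists>U. open U \<and> x \<in> U \<and> (\<forall>w\<in>U \<inter> S. f w < y))"
proof -
  have "(\<forall>\<^sub>F w in at x within S. f w < y) \<longleftrightarrow> (\<exists>U. open U \<and> x \<in> U \<and> (\<forall>w\<in>U \<inter> S. f w < y))"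
    if "f x < y" for x y
    unfolding eventually_at_topological using that by auto
  then show ?thesis unfolding usc_on_def by simp
qed

lemma usc_on_dist:
  fixes f :: "'a::metric_space \<Rightarrow> 'b::linorder"
  assumes "usc_on S f" "x \<in> S" "f x < y"
  obtains e where "e > 0" "\<And>w. w \<in> S \<Longrightarrow> dist w x < e \<Longrightarrow> f w < y"
proof -
  obtain d where "d > 0" "\<And>w. w \<in> S \<Longrightarrow> w \<noteq> x \<Longrightarrow> dist w x < d \<Longrightarrow> f w < y"
    using assms unfolding usc_on_def eventually_at by blast
  then show thesis using assms(3) by (intro that[of d]) auto
qed

lemma usc_on_compose:
  assumes "usc_on S f" "continuous_on T \<phi>" "\<phi> ` T \<subseteq> S"
  shows "usc_on T (\<lambda>x. f (\<phi> x))"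
  unfolding usc_on_iff_open
proof (intro ballI allI impI)
  fix x y assume x: "x \<in> T" and y: "f (\<phi> x) < y"
  have "f (\<phi> x) < y" "\<phi> x \<in> S" using x y assms(3) by auto
  then obtain U where U: "open U" "\<phi> x \<in> U" "\<forall>w\<in>U \<inter> S. f w < y"
    using assms(1) unfolding usc_on_iff_open by meson
  then obtain A where A: "open A" "x \<in> A" "\<forall>w\<in>T. w \<in> A \<longrightarrow> \<phi> w \<in> U"
    using assms(2)[unfolded continuous_on_topological, rule_format, OF x] by blast
  then have "\<forall>w\<in>A \<inter> T. f (\<phi> w) < y" using U(3) assms(3) by auto
  then show "\<exists>U. open U \<and> x \<in> U \<and> (\<forall>w\<in>U \<inter> T. f (\<phi> w) < y)"
    using A(1,2) by blast
qed

lemma usc_on_subset: "usc_on S f \<Longrightarrow> T \<subseteq> S \<Longrightarrow> usc_on T f"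
  using usc_on_compose[of S f T "\<lambda>x. x"] by auto

lemma usc_on_ereal:
  "usc_on S (\<lambda>x. ereal (f x)) \<longleftrightarrow> usc_on S f"
proof
  assume f: "usc_on S (\<lambda>x. ereal (f x))"
  show "usc_on S f" unfolding usc_on_def
  proof (intro ballI allI impI)
    fix x y assume "x \<in> S" "f x < y"
    then have "\<forall>\<^sub>F w in at x within S. ereal (f w) < ereal y"
      using f unfolding usc_on_def by (meson less_ereal.simps(1))
    then show "\<forall>\<^sub>F w in at x within S. f w < y" by simp
  qed
next
  assume f: "usc_on S f"
  show "usc_on S (\<lambda>x. ereal (f x))" unfolding usc_on_def
  proof (intro ballI allI impI)
    fix x and y assume "x \<in> S" "ereal (f x) < y"
    then show "\<forall>\<^sub>F w in at x within S. ereal (f w) < y"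
      using f by (cases y) (auto simp: usc_on_def)
  qed
qed

lemma usc_on_diff_continuous:
  fixes f h :: "'a::topological_space \<Rightarrow> real"
  assumes "usc_on S f" "continuous_on S h"
  shows "usc_on S (\<lambda>x. f x - h x)"
  unfolding usc_on_def
proof (intro ballI allI impI)
  fix x y assume x: "x \<in> S" and "f x - h x < y"
  define d where "d = (y - (f x - h x)) / 2"
  have d: "d > 0" using \<open>f x - h x < y\<close> by (simp add: d_def)
  have "\<forall>\<^sub>F w in at x within S. f w < f x + d"
    using assms(1) x d unfolding usc_on_def by simp
  moreover have "\<forall>\<^sub>F w in at x within S. h x - d < h w"
    using assms(2) x d by (intro order_tendstoD(1)[of h "h x"]) (auto simp: continuous_on_def)
  ultimately show "\<forall>\<^sub>F w in at x within S. f w - h w < y"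
  proof eventually_elim
    case (elim w)
    then show ?case unfolding d_def by (simp add: field_simps)
  qed
qed

text \<open>No supremum is formed, so any linear order is allowed. Without a maximum every
  \<open>x\<close> has a \<open>y x\<close> of larger value, and the neighbourhoods on which
  \<open>f\<close> stays below \<open>f (y x)\<close> cover \<open>K\<close>. In a finite subcover,
  the \<open>y x\<close> of largest value lies in one of these neighbourhoods, so some
  \<open>f (y x)\<close> is larger still.\<close>

lemma usc_on_attains_sup:
  fixes f :: "'a::topological_space \<Rightarrow> 'b::linorder"
  assumes "compact K" "K \<noteq> {}" "usc_on K f"
  shows "\<exists>x\<in>K. \<forall>y\<in>K. f y \<le> f x"
proof (rule ccontr)
  assume neg: "\<not> ?thesis"
  have "\<exists>p. open (fst p) \<and> x \<in> fst p \<and> snd p \<in> K \<and> (\<forall>w\<in>fst p \<inter> K. f w < f (snd p))"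
    if x: "x \<in> K" for x
  proof -
    obtain y where y: "y \<in> K" "f x < f y" using neg x by (meson not_le)
    then obtain U where "open U" "x \<in> U" "\<forall>w\<in>U \<inter> K. f w < f y"
      using assms(3) x unfolding usc_on_iff_open by meson
    then show ?thesis using y(1) by (intro exI[of _ "(U, y)"]) simp
  qed
  then have "\<exists>p. \<forall>x\<in>K. open (fst (p x)) \<and> x \<in> fst (p x) \<and> snd (p x) \<in> K \<and>
      (\<forall>w\<in>fst (p x) \<inter> K. f w < f (snd (p x)))"
    by (intro bchoice) blast
  then obtain p where p: "\<And>x. x \<in> K \<Longrightarrow> open (fst (p x)) \<and> x \<in> fst (p x) \<and> snd (p x) \<in> K \<and>
      (\<forall>w\<in>fst (p x) \<inter> K. f w < f (snd (p x)))" by blast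
  define U y where "U x = fst (p x)" and "y x = snd (p x)" for x
  have U: "\<And>x. x \<in> K \<Longrightarrow> open (U x)" "\<And>x. x \<in> K \<Longrightarrow> x \<in> U x"
    and y: "\<And>x. x \<in> K \<Longrightarrow> y x \<in> K" "\<And>x w. x \<in> K \<Longrightarrow> w \<in> U x \<Longrightarrow> w \<in> K \<Longrightarrow> f w < f (y x)"
    using p unfolding U_def y_def by auto
  obtain D where D: "D \<subseteq> K" "finite D" "K \<subseteq> (\<Union>x\<in>D. U x)"
    using compactE_image[OF assms(1), of K U] U by (metis UN_I subsetI)
  have "D \<noteq> {}" using D(3) assms(2) by auto
  define m where "m = Max ((\<lambda>x. f (y x)) ` D)"
  have "m \<in> (\<lambda>x. f (y x)) ` D" unfolding m_def using D(2) \<open>D \<noteq> {}\<close> by (intro Max_in) auto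
  then obtain x0 where x0: "x0 \<in> D" "m = f (y x0)" by auto
  then obtain x1 where x1: "x1 \<in> D" "y x0 \<in> U x1" using D y(1) by blast
  have "f (y x0) < f (y x1)" using y x0 x1 D(1) by blast
  moreover have "f (y x1) \<le> m" unfolding m_def using D(2) x1 by (intro Max_ge) auto
  ultimately show False using x0 by simp
qed

lemma usc_on_borel_measurable:
  fixes f :: "'a::topological_space \<Rightarrow> real"
  assumes "usc_on S f" "S \<in> sets borel"
  shows "f \<in> borel_measurable (restrict_space borel S)"
  unfolding borel_measurable_iff_less
proof
  fix y
  \<comment> \<open>Strict sublevel sets are relatively open: \<open>W\<close> is the largest open
    set on whose trace in \<open>S\<close> the function stays below \<open>y\<close>.\<close>
  define W where "W = \<Union>{U. open U \<and> (\<forall>w\<in>U \<inter> S. f w < y)}"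
  have "open W" unfolding W_def by (rule open_Union) auto
  have "w \<in> W" if w: "w \<in> S" "f w < y" for w
  proof -
    obtain U where "open U" "w \<in> U" "\<forall>x\<in>U \<inter> S. f x < y"
      using assms(1) w unfolding usc_on_iff_open by meson
    then show ?thesis unfolding W_def by auto
  qed
  then have "{w \<in> S. f w < y} = W \<inter> S"
    unfolding W_def by auto
  then show "{w \<in> space (restrict_space borel S). f w < y} \<in> sets (restrict_space borel S)"
    using \<open>open W\<close> assms(2) by (auto simp: space_restrict_space sets_restrict_space_iff)
qed

lemma usc_on_set_integrable:
  fixes f :: "real \<Rightarrow> real"
  assumes "usc_on {a..b} f" "\<And>t. t \<in> {a..b} \<Longrightarrow> c \<le> f t"
  shows "set_integrable lborel {a..b} f"
proof (cases "a \<le> b")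
  case True
  then obtain x where x: "x \<in> {a..b}" "\<And>t. t \<in> {a..b} \<Longrightarrow> f t \<le> f x"
    using usc_on_attains_sup[OF _ _ assms(1)] by auto
  have meas: "set_borel_measurable borel {a..b} f"
    using usc_on_borel_measurable[OF assms(1)]
    by (simp add: set_borel_measurable_def borel_measurable_restrict_space_iff)
  have "set_integrable lborel {a..b} (\<lambda>t. \<bar>c\<bar> + \<bar>f x\<bar>)"
    by (intro borel_integrable_atLeastAtMost' continuous_on_const)
  then show ?thesis
  proof (rule set_integrable_bound)
    show "set_borel_measurable lborel {a..b} f"
      using meas by (simp add: set_borel_measurable_def)
    show "AE t in lborel. t \<in> {a..b} \<longrightarrow> norm (f t) \<le> norm (\<bar>c\<bar> + \<bar>f x\<bar>)"
      using assms(2) x(2) by (intro AE_I2) force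
  qed
qed (simp add: set_integrable_def)

section \<open>Circle means and submean functions\<close>

text \<open>Integrability makes both parts finite, so the extended-real difference occurring in
  \<open>circle_mean\<close> is an ordinary integral.\<close>

lemma set_integral_eq_nn_integral_diff:
  assumes "set_integrable lborel A g"
  shows "enn2ereal (\<integral>\<^sup>+t\<in>A. ennreal (g t) \<partial>lborel) - enn2ereal (\<integral>\<^sup>+t\<in>A. ennreal (- g t) \<partial>lborel)
    = ereal (LINT t:A|lborel. g t)"
proof -
  define G where "G t = indicator A t *\<^sub>R g t" for t
  have G: "integrable lborel G" using assms unfolding set_integrable_def G_def .
  have fin: "(\<integral>\<^sup>+t. ennreal (G t) \<partial>lborel) \<noteq> top" "(\<integral>\<^sup>+t. ennreal (- G t) \<partial>lborel) \<noteq> top"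
    using G unfolding real_integrable_def by auto
  have e: "enn2ereal x = ereal (enn2real x)" if "x \<noteq> top" for x
    using that by (cases x) auto
  have parts: "(\<integral>\<^sup>+t\<in>A. ennreal (g t) \<partial>lborel) = (\<integral>\<^sup>+t. ennreal (G t) \<partial>lborel)"
    "(\<integral>\<^sup>+t\<in>A. ennreal (- g t) \<partial>lborel) = (\<integral>\<^sup>+t. ennreal (- G t) \<partial>lborel)"
    by (auto intro!: nn_integral_cong simp: G_def indicator_def)
  have "(LINT t:A|lborel. g t) = integral\<^sup>L lborel G"
    unfolding set_lebesgue_integral_def G_def ..
  then show ?thesis
    unfolding parts e[OF fin(1)] e[OF fin(2)] real_lebesgue_integral_def[OF G] by simp
qed

lemma circle_mean_eq:
  assumes "set_integrable lborel {0..2*pi} g"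
    and v: "\<And>t. t \<in> {0..2*pi} \<Longrightarrow> v (c + of_real r * cis t) = ereal (g t)"
  shows "circle_mean v c r = ereal ((LINT t:{0..2*pi}|lborel. g t) / (2*pi))"
proof -
  have "(\<integral>\<^sup>+t\<in>{0..2*pi}. e2ennreal (v (c + of_real r * cis t)) \<partial>lborel)
      = (\<integral>\<^sup>+t\<in>{0..2*pi}. ennreal (g t) \<partial>lborel)"
    "(\<integral>\<^sup>+t\<in>{0..2*pi}. e2ennreal (- v (c + of_real r * cis t)) \<partial>lborel)
      = (\<integral>\<^sup>+t\<in>{0..2*pi}. ennreal (- g t) \<partial>lborel)"
    by (auto intro!: nn_integral_cong simp: v indicator_def)
  then show ?thesis
    by (simp add: circle_mean_def set_integral_eq_nn_integral_diff[OF assms(1)])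
qed

text \<open>Measurability of \<open>v\<close> does not enter: the nonnegative integral is monotone
  for arbitrary functions, and a smaller \<open>v\<close> has a smaller positive and a larger
  negative part.\<close>

lemma circle_mean_le:
  assumes "set_integrable lborel {0..2*pi} g"
    and v: "\<And>t. t \<in> {0..2*pi} \<Longrightarrow> v (c + of_real r * cis t) \<le> ereal (g t)"
  shows "circle_mean v c r \<le> ereal ((LINT t:{0..2*pi}|lborel. g t) / (2*pi))"
proof -
  have 1: "e2ennreal (v (c + of_real r * cis t)) \<le> ennreal (g t)" if "t \<in> {0..2*pi}" for t
    using e2ennreal_mono[OF v[OF that]] by simp
  have 2: "ennreal (- g t) \<le> e2ennreal (- v (c + of_real r * cis t))" if "t \<in> {0..2*pi}" for t
  proof -
    have "ereal (- g t) \<le> - v (c + of_real r * cis t)"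
      using v[OF that] by (metis ereal_minus_le_minus uminus_ereal.simps(1))
    then show ?thesis using e2ennreal_mono by fastforce
  qed
  have "circle_mean v c r \<le> (enn2ereal (\<integral>\<^sup>+t\<in>{0..2*pi}. ennreal (g t) \<partial>lborel)
      - enn2ereal (\<integral>\<^sup>+t\<in>{0..2*pi}. ennreal (- g t) \<partial>lborel)) / ereal (2*pi)"
    unfolding circle_mean_def
    by (intro ereal_divide_right_mono ereal_minus_mono)
      (auto simp flip: less_eq_ennreal.rep_eq intro!: nn_integral_mono 1 2
        split: split_indicator)
  then show ?thesis by (simp add: set_integral_eq_nn_integral_diff[OF assms(1)])
qed

text \<open>The mean value inequality is stated through integrable majorants of the circle values: this form
  passes to suprema of families at once, without any measurability of the supremum.\<close>
definition submean :: "complex set \<Rightarrow> (complex \<Rightarrow> real) \<Rightarrow> bool" where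
  "submean D v \<longleftrightarrow> (\<forall>c r g. 0 < r \<and> cball c r \<subseteq> D \<and> set_integrable lborel {0..2*pi} g \<and>
     (\<forall>t\<in>{0..2*pi}. v (c + of_real r * cis t) \<le> g t) \<longrightarrow>
     2 * pi * v c \<le> (LINT t:{0..2*pi}|lborel. g t))"

lemma submeanD:
  assumes "submean D v" "0 < r" "cball c r \<subseteq> D" "set_integrable lborel {0..2*pi} g"
    and "\<And>t. t \<in> {0..2*pi} \<Longrightarrow> v (c + of_real r * cis t) \<le> g t"
  shows "2 * pi * v c \<le> (LINT t:{0..2*pi}|lborel. g t)"
  using assms unfolding submean_def by blast

lemma submean_subset: "submean D v \<Longrightarrow> E \<subseteq> D \<Longrightarrow> submean E v"
  unfolding submean_def by blast

section \<open>Comparison with quadratic superharmonic polynomials\<close>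

definition quad :: "real \<Rightarrow> real \<Rightarrow> real \<Rightarrow> real \<Rightarrow> complex \<Rightarrow> real" where
  "quad k l m n z = k + l * Re z + m * (Re z)\<^sup>2 + n * (Im z)\<^sup>2"

lemma continuous_on_quad [continuous_intros]:
  "continuous_on S f \<Longrightarrow> continuous_on S (\<lambda>x. quad k l m n (f x))"
  unfolding quad_def by (intro continuous_intros)

text \<open>The Laplacian of \<open>quad k l m n\<close> is the constant \<open>2 * (m + n)\<close>,
  so a circle mean differs from the central value by \<open>r\<^sup>2 * (m + n) / 2\<close>; for
  negative \<open>m + n\<close> the polynomial is strictly superharmonic.\<close>

lemma integral_quad_circle:
  "(LINT t:{0..2*pi}|lborel. quad k l m n (c + of_real r * cis t))
    = 2 * pi * quad k l m n c + pi * r\<^sup>2 * (m + n)"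
proof -
  \<comment> \<open>An antiderivative of the integrand; the last two summands integrate
    \<open>(cos t)\<^sup>2\<close> and \<open>(sin t)\<^sup>2\<close>.\<close>
  define F where "F t = quad k l m n c * t + (l * r + 2 * m * Re c * r) * sin t
    - 2 * n * Im c * r * cos t + m * r\<^sup>2 * ((t + sin t * cos t) / 2)
    + n * r\<^sup>2 * ((t - sin t * cos t) / 2)" for t
  have "(LINT t:{0..2*pi}|lborel. quad k l m n (c + of_real r * cis t))
    = (LINT t|lborel. quad k l m n (c + of_real r * cis t) * indicator {0..2*pi} t)"
    unfolding set_lebesgue_integral_def by (simp add: mult.commute)
  also have "\<dots> = F (2*pi) - F 0"
  proof (rule integral_FTC_Icc_real)
    fix t
    have D: "(F has_real_derivative (quad k l m n c + (l * r + 2 * m * Re c * r) * cos t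
      + 2 * n * Im c * r * sin t + m * r\<^sup>2 * ((1 + (cos t * cos t - sin t * sin t)) / 2)
      + n * r\<^sup>2 * ((1 - (cos t * cos t - sin t * sin t)) / 2))) (at t)"
      unfolding F_def by (auto intro!: derivative_eq_intros simp: field_simps)
    have half: "(1 + (cos t * cos t - sin t * sin t)) / 2 = (cos t)\<^sup>2"
      "(1 - (cos t * cos t - sin t * sin t)) / 2 = (sin t)\<^sup>2"
      using sin_cos_squared_add[of t] by (auto simp: power2_eq_square)
    show "(F has_real_derivative quad k l m n (c + of_real r * cis t)) (at t)"
      using D unfolding half by (simp add: quad_def power2_eq_square algebra_simps)
    show "isCont (\<lambda>t. quad k l m n (c + of_real r * cis t)) t"
      by (simp add: quad_def)
  qed simp
  also have "\<dots> = 2 * pi * quad k l m n c + pi * r\<^sup>2 * (m + n)"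
    unfolding F_def by (simp add: algebra_simps)
  finally show ?thesis .
qed

text \<open>Maximum principle for \<open>v\<close> minus the polynomial. Because the
  superharmonicity is strict, an interior maximum is already contradicted on one small circle, and
  no connectedness argument is required.\<close>

lemma superharmonic_quad_majorant:
  assumes K: "compact K" and usc: "usc_on K v" and sub: "submean K v" and neg: "m + n < 0"
    and bd: "\<And>p. p \<in> K \<Longrightarrow> p \<notin> interior K \<Longrightarrow> v p \<le> quad k l m n p"
    and "p \<in> K"
  shows "v p \<le> quad k l m n p"
proof -
  let ?h = "quad k l m n"
  have "usc_on K (\<lambda>z. v z - ?h z)"
    by (intro usc_on_diff_continuous usc continuous_intros)
  then obtain q where q: "q \<in> K" "\<And>z. z \<in> K \<Longrightarrow> v z - ?h z \<le> v q - ?h q"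
    using usc_on_attains_sup[OF K] \<open>p \<in> K\<close> by blast
  have "v q \<le> ?h q"
  proof (cases "q \<in> interior K")
    case True
    then obtain r where r: "r > 0" "cball q r \<subseteq> K"
      by (meson mem_interior_cball)
    \<comment> \<open>Raising the polynomial by the maximal difference gives a majorant of
      \<open>v\<close> on \<open>K\<close> that touches it at \<open>q\<close>.\<close>
    let ?s = "v q - ?h q"
    have *: "quad (k + ?s) l m n z = ?h z + ?s" for z by (simp add: quad_def)
    have "2 * pi * v q \<le> (LINT t:{0..2*pi}|lborel. quad (k + ?s) l m n (q + of_real r * cis t))"
    proof (rule submeanD[OF sub r])
      show "set_integrable lborel {0..2*pi} (\<lambda>t. quad (k + ?s) l m n (q + of_real r * cis t))"
        by (intro borel_integrable_atLeastAtMost' continuous_intros)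
      fix t
      have "q + of_real r * cis t \<in> K"
        using r by (intro subsetD[OF r(2)]) (simp add: dist_norm norm_mult)
      from q(2)[OF this] show "v (q + of_real r * cis t) \<le> quad (k + ?s) l m n (q + of_real r * cis t)"
        unfolding * by simp
    qed
    also have "\<dots> = 2 * pi * v q + pi * r\<^sup>2 * (m + n)"
      unfolding integral_quad_circle *[of q] by simp
    finally have "0 \<le> pi * r\<^sup>2 * (m + n)" by simp
    moreover have "pi * r\<^sup>2 * (m + n) < 0" using r neg by (simp add: mult_pos_neg)
    ultimately show ?thesis by simp
  qed (use bd q in blast)
  then show ?thesis using q(2)[OF \<open>p \<in> K\<close>] by simp
qed

text \<open>The set where the majorant is compared with \<open>v\<close> is the part of the disc about 1 lying on the same
  side of the unit circle as \<open>c\<close>. For \<open>c \<le> 1\<close> the barrier is \<open>(1 - x) + (1 - \<bar>z\<bar>\<^sup>2)\<close>; for \<open>c > 1\<close>, with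
  \<open>s = x - 1\<close>, it is \<open>s/2 - 5/4 s\<^sup>2 + 3/4 y\<^sup>2\<close>. Both are nonnegative on the unit circle near 1, at
  least a multiple of \<open>\<rho>\<^sup>2\<close> on the remaining boundary, and vanish at 1.\<close>
lemma center_bound_by_arc:
  fixes c \<rho> :: real
  assumes \<rho>: "0 < \<rho>" "\<rho> \<le> 1/4" and c: "\<bar>c - 1\<bar> \<le> \<rho>" and L: "0 < L"
    and usc: "usc_on (cball 1 \<rho>) v" and sub: "submean (cball 1 \<rho>) v"
    and up: "\<And>z. z \<in> cball 1 \<rho> \<Longrightarrow> v z \<le> M + L"
    and arc: "\<And>z. z \<in> cball 1 \<rho> \<Longrightarrow> norm z = 1 \<Longrightarrow> v z \<le> M"
  shows "v (of_real c) \<le> M + 12 * L / \<rho>\<^sup>2 * \<bar>c - 1\<bar>"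
proof -
  have norm2: "(norm z)\<^sup>2 = (Re z)\<^sup>2 + (Im z)\<^sup>2" for z :: complex by (rule cmod_power2)
  have dist2: "(dist 1 z)\<^sup>2 = (Re z - 1)\<^sup>2 + (Im z)\<^sup>2" for z :: complex
    by (simp add: dist_norm cmod_power2 power2_commute)
  have c_in: "of_real c \<in> cball (1::complex) \<rho>"
    using c dist_of_real[of 1 c, where 'a = complex] by (simp add: dist_real_def abs_minus_commute)
  have "c > 0" using c \<rho> by linarith
  show ?thesis
  proof (cases "c \<le> 1")
    case True
    define K where "K = cball 0 1 \<inter> cball (1::complex) \<rho>"
    \<comment> \<open>On the part of K with |z - 1| = \<rho> one has \<rho>^2 \<le> 2 (1 - Re z), so
      this \<open>A\<close> lifts the barrier to at least M + L there.\<close>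
    define A where "A = 2 * L / \<rho>\<^sup>2"
    have A: "A > 0" "A * \<rho>\<^sup>2 = 2 * L" using L \<rho> by (auto simp: A_def)
    let ?h = "quad (M + 2 * A) (- A) (- A) (- A)"
    have h: "?h z = M + A * (1 - Re z) + A * (1 - (norm z)\<^sup>2)" for z
      unfolding quad_def norm2 by (simp add: algebra_simps)
    have "v (of_real c) \<le> ?h (of_real c)"
    proof (rule superharmonic_quad_majorant)
      show "compact K" unfolding K_def by (intro compact_Int compact_cball)
      show "usc_on K v" "submean K v"
        using usc sub unfolding K_def by (auto intro: usc_on_subset submean_subset)
      show "of_real c \<in> K" using c_in \<open>c > 0\<close> True by (simp add: K_def)
      fix z assume z: "z \<in> K" "z \<notin> interior K"
      have n1: "norm z \<le> 1" "dist 1 z \<le> \<rho>" using z by (auto simp: K_def)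
      have "Re z \<le> 1" using complex_Re_le_cmod[of z] n1 by linarith
      \<comment> \<open>The open lens is contained in the interior of \<open>K\<close>; a boundary
        point therefore lies on one of the two circles.\<close>
      have "z \<notin> ball 0 1 \<inter> ball 1 \<rho>"
        using z(2) interior_maximal[of "ball 0 1 \<inter> ball 1 \<rho>" K] unfolding K_def by fastforce
      with n1 consider "norm z = 1" | "dist 1 z = \<rho>" by fastforce
      then show "v z \<le> ?h z"
      proof cases
        case 1
        then have "v z \<le> M" using z arc by (simp add: K_def)
        moreover have "0 \<le> A * (1 - Re z)" using \<open>Re z \<le> 1\<close> A(1) by simp
        ultimately show ?thesis unfolding h using 1 by simp
      next
        case 2
        have "(norm z)\<^sup>2 \<le> 1" using n1 by (simp add: power_le_one)
        moreover have "\<rho>\<^sup>2 = (norm z)\<^sup>2 - 2 * Re z + 1"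
          using dist2[of z] unfolding 2 norm2 by (simp add: power2_eq_square algebra_simps)
        ultimately have "\<rho>\<^sup>2 \<le> 2 * (1 - Re z)" by simp
        then have "A * \<rho>\<^sup>2 \<le> A * (2 * (1 - Re z))" using A by (intro mult_left_mono) auto
        then have "L \<le> A * (1 - Re z)" using A(2) by (simp add: algebra_simps)
        moreover have "0 \<le> A * (1 - (norm z)\<^sup>2)" using A \<open>(norm z)\<^sup>2 \<le> 1\<close> by simp
        moreover have "v z \<le> M + L" using up z by (simp add: K_def)
        ultimately show ?thesis unfolding h by simp
      qed
    qed (use A in auto)
    also have "\<dots> = M + A * ((1 - c) * (2 + c))"
      unfolding h using \<open>c > 0\<close> by (simp add: power2_eq_square algebra_simps)
    also have "\<dots> \<le> M + A * ((1 - c) * 3)"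
      using A True \<open>c > 0\<close> by (intro add_left_mono mult_left_mono) auto
    \<comment> \<open>A factor 2 is given away so that both cases end with the constant 12.\<close>
    also have "\<dots> \<le> M + 6 * A * (1 - c)" using A True by simp
    also have "\<dots> = M + 12 * L / \<rho>\<^sup>2 * \<bar>c - 1\<bar>" using True by (simp add: A_def)
    finally show ?thesis .
  next
    case False
    define K where "K = - ball 0 1 \<inter> cball (1::complex) \<rho>"
    \<comment> \<open>On |z - 1| = \<rho> the bracket of the barrier will be at least \<rho>^2 / 4,
      and \<open>A\<close> makes this at least \<open>L\<close>.\<close>
    define A where "A = 4 * L / \<rho>\<^sup>2"
    have A: "A > 0" "A * \<rho>\<^sup>2 = 4 * L" using L \<rho> by (auto simp: A_def)
    let ?h = "quad (M - 7/4 * A) (3 * A) (- 5/4 * A) (3/4 * A)"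
    \<comment> \<open>Written with the distance to 1, which is constant on the outer boundary and
      determines \<open>Re z\<close> on the unit circle.\<close>
    have h: "?h z = M + A * (1/2 * (Re z - 1) - 2 * (Re z - 1)\<^sup>2 + 3/4 * (dist 1 z)\<^sup>2)" for z
      unfolding quad_def dist2 by (simp add: power2_eq_square field_simps)
    have "v (of_real c) \<le> ?h (of_real c)"
    proof (rule superharmonic_quad_majorant)
      show "compact K" unfolding K_def by (intro closed_Int_compact compact_cball) auto
      show "usc_on K v" "submean K v"
        using usc sub unfolding K_def by (auto intro: usc_on_subset submean_subset)
      show "of_real c \<in> K" using c_in \<open>c > 0\<close> False by (simp add: K_def)
      fix z assume z: "z \<in> K" "z \<notin> interior K"
      have n1: "1 \<le> norm z" "dist 1 z \<le> \<rho>" using z by (auto simp: K_def)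
      have "z \<notin> - cball 0 1 \<inter> ball 1 \<rho>"
        using z(2) interior_maximal[of "- cball 0 1 \<inter> ball 1 \<rho>" K] unfolding K_def
        by (fastforce simp: open_Compl)
      with n1 consider "norm z = 1" | "dist 1 z = \<rho>" by fastforce
      then show "v z \<le> ?h z"
      proof cases
        case 1
        define d where "d = (dist 1 z)\<^sup>2"
        have "d \<le> \<rho>\<^sup>2" unfolding d_def using n1 by (intro power_mono) auto
        also have "\<dots> \<le> (1/4)\<^sup>2" using \<rho> by (intro power_mono) auto
        finally have d: "d \<le> 1" "0 \<le> d" by (auto simp: d_def power2_eq_square)
        \<comment> \<open>On the unit circle |z - 1|^2 = 2 - 2 Re z, so the bracket becomes d (1 -
          d) / 2.\<close>
        have s: "Re z - 1 = - d / 2"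
          using dist2[of z] norm2[of z] 1 by (simp add: d_def power2_eq_square algebra_simps)
        have "?h z = M + A * (d * (1 - d) / 2)"
          unfolding h s d_def[symmetric] by (simp add: power2_eq_square field_simps)
        moreover have "0 \<le> A * (d * (1 - d) / 2)" using A d by simp
        moreover have "v z \<le> M" using z arc 1 by (simp add: K_def)
        ultimately show ?thesis by simp
      next
        case 2
        define s where "s = Re z - 1"
        have "1 \<le> (norm z)\<^sup>2" using n1 by simp
        moreover have "\<rho>\<^sup>2 = (norm z)\<^sup>2 - 2 * s - 1"
          using dist2[of z] unfolding 2 norm2 s_def by (simp add: power2_eq_square algebra_simps)
        ultimately have s1: "- \<rho>\<^sup>2 \<le> 2 * s" by simp
        have s2: "\<bar>s\<bar> \<le> \<rho>"
          using abs_Re_le_cmod[of "z - 1"] 2 by (simp add: s_def dist_norm norm_minus_commute)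
        have \<rho>2: "\<rho>\<^sup>2 \<le> \<rho> / 4" using \<rho> by (simp add: power2_eq_square mult_left_mono)
        \<comment> \<open>For s \<ge> 0 the linear term absorbs 2 s^2 because s \<le> 1/4. For s < 0
          the condition |z| \<ge> 1 forces |s| \<le> \<rho>^2 / 2, so the first two terms cost at
          most 3/8 \<rho>^2.\<close>
        have "1/4 * \<rho>\<^sup>2 \<le> 1/2 * s - 2 * s\<^sup>2 + 3/4 * \<rho>\<^sup>2"
        proof (cases "0 \<le> s")
          case True
          have "s * s \<le> s * (1/4)" using True s2 \<rho> by (intro mult_left_mono) auto
          then show ?thesis by (simp add: power2_eq_square)
        next
          case False
          have "- s \<le> \<rho>\<^sup>2 / 2" using s1 by simp
          moreover have "\<rho>\<^sup>2 / 2 \<le> 1/8" using \<rho>2 \<rho> by simp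
          moreover have "s\<^sup>2 = (- s) * (- s)" by (simp add: power2_eq_square)
          moreover have "(- s) * (- s) \<le> (\<rho>\<^sup>2 / 2) * (1/8)"
            using False calculation(1,2) by (intro mult_mono) auto
          ultimately have "s\<^sup>2 \<le> \<rho>\<^sup>2 / 16" by linarith
          then show ?thesis using s1 zero_le_power2[of \<rho>] by linarith
        qed
        then have "A * (1/4 * \<rho>\<^sup>2) \<le> A * (1/2 * s - 2 * s\<^sup>2 + 3/4 * \<rho>\<^sup>2)"
          using A by (intro mult_left_mono) auto
        then have "L \<le> A * (1/2 * s - 2 * s\<^sup>2 + 3/4 * \<rho>\<^sup>2)" using A(2) by linarith
        moreover have "v z \<le> M + L" using up z by (simp add: K_def)
        ultimately show ?thesis unfolding h 2 s_def by simp
      qed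
    qed (use A in auto)
    also have "\<dots> = M + A * ((c - 1) / 2 - 5/4 * (c - 1)\<^sup>2)"
      unfolding h dist2 by (simp add: power2_eq_square field_simps)
    also have "\<dots> \<le> M + A * (3 * (c - 1))"
    proof (intro add_left_mono mult_left_mono)
      show "(c - 1) / 2 - 5/4 * (c - 1)\<^sup>2 \<le> 3 * (c - 1)"
        using False zero_le_power2[of "c - 1"] by argo
    qed (use A in simp)
    also have "\<dots> = M + 12 * L / \<rho>\<^sup>2 * \<bar>c - 1\<bar>"
      using False by (simp add: A_def)
    finally show ?thesis .
  qed
qed

section \<open>Regularization and plurisubharmonic functions\<close>

text \<open>A bound for \<open>u\<close> on an open set bounds the regularization at every point of
  that set. The intermediate \<open>y'\<close> restores the strict inequality that passing to the
  limsup weakens.\<close>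

lemma usc_reg_usc:
  fixes u :: "'a::topological_space \<Rightarrow> ereal"
  shows "usc_on S (usc_reg S u)"
  unfolding usc_on_iff_open
proof (intro ballI allI impI)
  fix x y assume "x \<in> S" "usc_reg S u x < y"
  then obtain y' where y': "usc_reg S u x < y'" "y' < y" using dense by blast
  then have "\<forall>\<^sub>F w in inf (nhds x) (principal S). u w < y'"
    unfolding usc_reg_def by (intro Limsup_lessD)
  then obtain U where U: "open U" "x \<in> U" "\<forall>w\<in>U. w \<in> S \<longrightarrow> u w < y'"
    unfolding eventually_inf_principal eventually_nhds by auto
  have "usc_reg S u w < y" if "w \<in> U" for w
  proof -
    have "\<forall>\<^sub>F v in inf (nhds w) (principal S). u v \<le> y'"
      unfolding eventually_inf_principal eventually_nhds using U that less_imp_le by blast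
    then have "usc_reg S u w \<le> y'" unfolding usc_reg_def by (rule Limsup_bounded)
    then show ?thesis using y' by simp
  qed
  then show "\<exists>U. open U \<and> x \<in> U \<and> (\<forall>w\<in>U \<inter> S. usc_reg S u w < y)" using U(1,2) by blast
qed

text \<open>An upper semicontinuous majorant absorbs the regularization, so the constraint defining
  the envelope can be checked pointwise.\<close>

lemma usc_reg_le:
  fixes u F :: "'a::topological_space \<Rightarrow> ereal"
  assumes "usc_on S F" "\<And>x. x \<in> S \<Longrightarrow> u x \<le> F x" "x \<in> S"
  shows "usc_reg S u x \<le> F x"
proof (rule dense_ge)
  fix y assume "F x < y"
  then obtain U where "open U" "x \<in> U" "\<forall>w\<in>U \<inter> S. F w < y"
    using assms(1,3) unfolding usc_on_iff_open by meson
  then have "\<forall>\<^sub>F v in inf (nhds x) (principal S). u v \<le> y"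
    unfolding eventually_inf_principal eventually_nhds using assms(2) by (meson IntI le_less_trans less_imp_le)
  then show "usc_reg S u x \<le> y" unfolding usc_reg_def by (rule Limsup_bounded)
qed

lemma usc_reg_approx:
  fixes u :: "'a::metric_space \<Rightarrow> ereal"
  assumes "y < usc_reg S u x" "e > 0"
  shows "\<exists>w\<in>S. dist w x < e \<and> y < u w"
proof (rule ccontr)
  assume "\<not> ?thesis"
  then have "\<forall>w. dist w x < e \<longrightarrow> w \<in> S \<longrightarrow> u w \<le> y" by auto
  then have "\<forall>\<^sub>F v in inf (nhds x) (principal S). u v \<le> y"
    unfolding eventually_inf_principal eventually_nhds_metric using assms(2) by blast
  then have "usc_reg S u x \<le> y" unfolding usc_reg_def by (rule Limsup_bounded)
  then show False using assms(1) by simp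
qed

text \<open>The mean value part of plurisubharmonicity, kept apart from upper semicontinuity: the
  supremum of the competitors has it before its upper semicontinuity is known.\<close>

definition pluri_submean :: "(complex ^ 'n) set \<Rightarrow> (complex ^ 'n \<Rightarrow> real) \<Rightarrow> bool" where
  "pluri_submean \<Omega> f \<longleftrightarrow> (\<forall>a b. submean {w. a + w *s b \<in> \<Omega>} (\<lambda>w. f (a + w *s b)))"

lemma continuous_on_scalar_mult_vec [continuous_intros]:
  "continuous_on S \<phi> \<Longrightarrow> continuous_on S \<psi> \<Longrightarrow> continuous_on S (\<lambda>x. \<phi> x *s (\<psi> x :: complex ^ 'n))"
  unfolding vector_scalar_mult_def by (intro continuous_intros)

lemma continuous_on_cis_real [continuous_intros]:
  "continuous_on S \<phi> \<Longrightarrow> continuous_on S (\<lambda>x. cis (\<phi> x))"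
  unfolding cis_conv_exp by (intro continuous_intros)

lemma usc_on_line:
  fixes f :: "complex ^ 'n \<Rightarrow> 'b::linorder"
  assumes "usc_on \<Omega> f"
  shows "usc_on {w. a + w *s b \<in> \<Omega>} (\<lambda>w. f (a + w *s b))"
  by (rule usc_on_compose[OF assms]) (auto intro!: continuous_intros)

lemma set_integrable_on_circle:
  fixes f :: "complex ^ 'n \<Rightarrow> real"
  assumes "usc_on \<Omega> f" "\<And>z. z \<in> \<Omega> \<Longrightarrow> m \<le> f z"
    and "\<And>t. a + (c + of_real r * cis t) *s b \<in> \<Omega>"
  shows "set_integrable lborel {0..2*pi} (\<lambda>t. f (a + (c + of_real r * cis t) *s b))"
  using assms(2,3)
  by (intro usc_on_set_integrable[where c = m] usc_on_compose[OF assms(1)])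
    (auto intro!: continuous_intros)

text \<open>The values of \<open>f\<close> on a circle serve as their own integrable majorant; the
  lower bound \<open>m\<close> and upper semicontinuity provide the integrability.\<close>

lemma psh_on_ereal:
  fixes f :: "complex ^ 'n \<Rightarrow> real"
  assumes usc: "usc_on \<Omega> f" and m: "\<And>z. z \<in> \<Omega> \<Longrightarrow> m \<le> f z" and sub: "pluri_submean \<Omega> f"
  shows "psh_on \<Omega> (\<lambda>z. ereal (f z))"
proof -
  have mean: "ereal (f (a + c *s b)) \<le> circle_mean (\<lambda>w. ereal (f (a + w *s b))) c r"
    if r: "0 < r" and D: "cball c r \<subseteq> {w. a + w *s b \<in> \<Omega>}" for a b c r
  proof -
    have "c + of_real r * cis t \<in> {w. a + w *s b \<in> \<Omega>}" for t
      using r by (intro subsetD[OF D]) (simp add: dist_norm norm_mult)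
    then have int: "set_integrable lborel {0..2*pi} (\<lambda>t. f (a + (c + of_real r * cis t) *s b))"
      by (intro set_integrable_on_circle[OF usc m]) auto
    have "2 * pi * f (a + c *s b) \<le> (LINT t:{0..2*pi}|lborel. f (a + (c + of_real r * cis t) *s b))"
      using submeanD[OF _ r D int, where v = "\<lambda>w. f (a + w *s b)"] sub unfolding pluri_submean_def by simp
    then show ?thesis
      using circle_mean_eq[OF int, of "\<lambda>w. ereal (f (a + w *s b))" c r] by (simp add: field_simps)
  qed
  then show ?thesis
    using usc usc_on_line[OF usc] unfolding psh_on_def subharmonic_on_def
    by (auto simp: usc_on_ereal)
qed

text \<open>Given a disc with centre \<open>z\<close>, choose \<open>x n\<close> tending to
  \<open>z\<close> with \<open>p (x n)\<close> approaching \<open>q z\<close>, apply the mean value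
  inequality for \<open>p\<close> on the translated discs with a majorant built from
  \<open>q\<close>, and pass to the limit by dominated convergence.\<close>

lemma usc_regularization_submean:
  fixes p F :: "complex ^ 'n \<Rightarrow> real"
  assumes "open \<Omega>" and F: "usc_on \<Omega> F"
    and m: "\<And>z. z \<in> \<Omega> \<Longrightarrow> m \<le> p z" and pF: "\<And>z. z \<in> \<Omega> \<Longrightarrow> p z \<le> F z"
    and sub: "pluri_submean \<Omega> p"
  obtains q where "usc_on \<Omega> q" "\<And>z. z \<in> \<Omega> \<Longrightarrow> p z \<le> q z" "\<And>z. z \<in> \<Omega> \<Longrightarrow> q z \<le> F z"
    "pluri_submean \<Omega> q"
proof -
  let ?P = "\<lambda>z. ereal (p z)"
  define q where "q z = real_of_ereal (usc_reg \<Omega> ?P z)" for z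
  have P1: "?P z \<le> usc_reg \<Omega> ?P z" if "z \<in> \<Omega>" for z using usc_reg_ge[OF that] .
  have P2: "usc_reg \<Omega> ?P z \<le> ereal (F z)" if "z \<in> \<Omega>" for z
    using usc_reg_le[of \<Omega> "\<lambda>z. ereal (F z)" ?P z] F pF that by (simp add: usc_on_ereal)
  have q: "usc_reg \<Omega> ?P z = ereal (q z)" if "z \<in> \<Omega>" for z
    using P1[OF that] P2[OF that] unfolding q_def by (cases "usc_reg \<Omega> ?P z") auto
  have pq: "p z \<le> q z" and qF: "q z \<le> F z" if "z \<in> \<Omega>" for z
    using P1[OF that] P2[OF that] q[OF that] by auto
  have usc: "usc_on \<Omega> q"
  proof -
    have "usc_on \<Omega> (\<lambda>z. ereal (q z))"
      using usc_reg_usc[of \<Omega> ?P] q unfolding usc_on_iff_open by (metis IntD2)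
    then show ?thesis by (simp add: usc_on_ereal)
  qed
  have mq: "m \<le> q z" if "z \<in> \<Omega>" for z using m pq that by fastforce
  have "pluri_submean \<Omega> q"
    unfolding pluri_submean_def submean_def
  proof (intro allI impI, elim conjE)
    fix a b c r g
    assume r: "0 < r" and D: "cball c r \<subseteq> {w. a + w *s b \<in> \<Omega>}"
      and g: "set_integrable lborel {0..2*pi} g"
      and qg: "\<forall>t\<in>{0..2*pi}. q (a + (c + of_real r * cis t) *s b) \<le> g t"
    define z where "z = a + c *s b"
    define C where "C t = (of_real r * cis t) *s b" for t
    have aC: "a + (c + of_real r * cis t) *s b = z + C t" for t
      unfolding z_def C_def by (simp add: vector_sadd_rdistrib)
    define K where "K = (\<lambda>w. a + w *s b) ` cball c r"
    have "compact K" unfolding K_def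
      by (intro compact_continuous_image compact_cball continuous_intros)
    have "K \<subseteq> \<Omega>" unfolding K_def using D by auto
    \<comment> \<open>A compact neighbourhood of the disc inside \<Omega>: it contains all
      translated discs, and \<open>q\<close> is bounded above on it, which gives the dominating
      constant.\<close>
    obtain e where e: "e > 0" "(\<Union>x\<in>K. cball x e) \<subseteq> \<Omega>"
      using compact_subset_open_imp_cball_epsilon_subset[OF \<open>compact K\<close> \<open>open \<Omega>\<close> \<open>K \<subseteq> \<Omega>\<close>] .
    have near: "x + w *s b \<in> (\<Union>x\<in>K. cball x e)" if "dist x z \<le> e" "norm w \<le> r" for x w
    proof -
      have "dist c (c + w) \<le> r" using that(2) by (simp add: dist_norm)
      then have "z + w *s b \<in> K"
        unfolding K_def z_def by (intro image_eqI[of _ _ "c + w"]) (auto simp: vector_sadd_rdistrib)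
      moreover have "dist (z + w *s b) (x + w *s b) \<le> e" using that(1) by (simp add: dist_commute)
      ultimately show ?thesis by (intro UN_I) (auto simp: mem_cball)
    qed
    have Cr: "norm (of_real r * cis t) \<le> r" for t using r by (simp add: norm_mult)
    have near\<Omega>: "x + C t \<in> \<Omega>" if "dist x z \<le> e" for x t
      using subsetD[OF e(2) near[OF that Cr]] unfolding C_def .
    have z: "z \<in> \<Omega>" using subsetD[OF e(2) near[of z 0]] e(1) r by simp
    obtain M where M: "\<And>x. x \<in> (\<Union>x\<in>K. cball x e) \<Longrightarrow> q x \<le> M"
    proof -
      have "usc_on (\<Union>x\<in>K. cball x e) q" using usc_on_subset[OF usc e(2)] .
      moreover have "(\<Union>x\<in>K. cball x e) \<noteq> {}" using near[of z 0] e r by auto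
      ultimately have "\<exists>y\<in>(\<Union>x\<in>K. cball x e). \<forall>x\<in>(\<Union>x\<in>K. cball x e). q x \<le> q y"
        by (intro usc_on_attains_sup compact_minkowski_sum_cball \<open>compact K\<close>)
      then obtain y where "\<forall>x\<in>(\<Union>x\<in>K. cball x e). q x \<le> q y" by (elim bexE)
      then show thesis by (intro that[of "q y"]) (elim bspec)
    qed
    have "\<forall>n. \<exists>x\<in>\<Omega>. dist x z < e / real (Suc n) \<and> ereal (q z - 1 / real (Suc n)) < ereal (p x)"
      using e(1) by (intro allI usc_reg_approx) (simp_all add: q[OF z])
    then obtain x where x: "\<And>n. x n \<in> \<Omega>" "\<And>n. dist (x n) z < e / real (Suc n)"
      "\<And>n. q z - 1 / real (Suc n) < p (x n)"
      unfolding Bex_def less_ereal.simps(1) choice_iff by blast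
    have xe: "dist (x n) z \<le> e" for n
    proof -
      have "e / real (Suc n) \<le> e / 1" using e(1) by (intro divide_left_mono) auto
      then show ?thesis using x(2)[of n] by simp
    qed
    have "(\<lambda>n. e / real (Suc n)) \<longlonglongrightarrow> 0" by real_asymp
    then have "(\<lambda>n. dist (x n) z) \<longlonglongrightarrow> 0"
      by (rule Lim_null_comparison[rotated]) (use x(2) in \<open>auto intro!: always_eventually less_imp_le\<close>)
    then have xlim: "x \<longlonglongrightarrow> z" by (simp only: tendsto_dist_iff[symmetric])
    \<comment> \<open>By upper semicontinuity the maxima below converge pointwise, although \<open>q (x n + C t)\<close> need not.\<close>
    define I where "I t = indicator {0..2*pi} t * q (z + C t)" for t
    define J where "J n t = indicator {0..2*pi} t * max (q (x n + C t)) (q (z + C t))" for n t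
    have int0: "set_integrable lborel {0..2*pi} (\<lambda>t. q (y + C t))" if "dist y z \<le> e" for y
      using set_integrable_on_circle[OF usc mq, of y 0 r b] near\<Omega>[OF that]
      unfolding C_def by simp
    have J: "J n = (\<lambda>t. max (indicator {0..2*pi} t *\<^sub>R q (x n + C t)) (indicator {0..2*pi} t *\<^sub>R q (z + C t)))"
      for n unfolding J_def by (auto simp: indicator_def)
    then have intJ: "integrable lborel (J n)" for n
      unfolding J using int0[OF xe[of n]] int0[of z] e(1) unfolding set_integrable_def
      by (intro integrable_max) auto
    have lim: "(\<lambda>n. integral\<^sup>L lborel (J n)) \<longlonglongrightarrow> integral\<^sup>L lborel I"
    proof (rule integral_dominated_convergence)
      show "I \<in> borel_measurable lborel"
        using int0[of z] e(1) unfolding set_integrable_def I_def by (simp add: borel_measurable_integrable)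
      show "J n \<in> borel_measurable lborel" for n using intJ[of n] by (rule borel_measurable_integrable)
      have "set_integrable lborel {0..2*pi} (\<lambda>t. \<bar>m\<bar> + \<bar>M\<bar>)"
        by (intro borel_integrable_atLeastAtMost' continuous_on_const)
      then show "integrable lborel (\<lambda>t. indicator {0..2*pi} t * (\<bar>m\<bar> + \<bar>M\<bar>))"
        unfolding set_integrable_def by simp
      show "AE t in lborel. norm (J n t) \<le> indicator {0..2*pi} t * (\<bar>m\<bar> + \<bar>M\<bar>)" for n
      proof (rule AE_I2)
        fix t
        have "\<bar>q (y + C t)\<bar> \<le> \<bar>m\<bar> + \<bar>M\<bar>" if "dist y z \<le> e" for y
          using M[OF near[OF that Cr[of t]]] mq[OF near\<Omega>[OF that, of t]]
          unfolding C_def by linarith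
        from this[OF xe[of n]] this[of z] show "norm (J n t) \<le> indicator {0..2*pi} t * (\<bar>m\<bar> + \<bar>M\<bar>)"
          unfolding J_def using e(1) by (auto simp: max_def indicator_def)
      qed
      show "AE t in lborel. (\<lambda>n. J n t) \<longlonglongrightarrow> I t"
      proof (rule AE_I2)
        fix t
        have "(\<lambda>n. max (q (x n + C t)) (q (z + C t))) \<longlonglongrightarrow> q (z + C t)"
        proof (rule order_tendstoI)
          fix y assume "q (z + C t) < y"
          moreover have "z + C t \<in> \<Omega>" using near\<Omega>[of z] e(1) by simp
          ultimately obtain d where d: "d > 0" "\<And>w. w \<in> \<Omega> \<Longrightarrow> dist w (z + C t) < d \<Longrightarrow> q w < y"
            using usc_on_dist[OF usc] by metis
          have "\<forall>\<^sub>F n in sequentially. dist (x n) z < d"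
            using xlim d(1) by (rule tendstoD)
          then show "\<forall>\<^sub>F n in sequentially. max (q (x n + C t)) (q (z + C t)) < y"
          proof eventually_elim
            case (elim n)
            have "x n + C t \<in> \<Omega>" using near\<Omega>[OF xe] .
            then show ?case using d(2)[of "x n + C t"] elim \<open>q (z + C t) < y\<close> by simp
          qed
        qed (auto intro!: always_eventually simp: less_max_iff_disj)
        then show "(\<lambda>n. J n t) \<longlonglongrightarrow> I t"
          unfolding J_def I_def by (rule tendsto_mult_left)
      qed
    qed
    have "\<forall>n\<ge>0. 2 * pi * (q z - 1 / real (Suc n)) \<le> integral\<^sup>L lborel (J n)"
    proof (intro allI impI)
      fix n
      \<comment> \<open>The line keeps its direction \<open>b\<close> but is based at
        \<open>x n\<close>, so the translated disc is centred at parameter 0.\<close>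
      have "2 * pi * p (x n + 0 *s b) \<le> (LINT t:{0..2*pi}|lborel. max (q (x n + C t)) (q (z + C t)))"
      proof (rule submeanD[of "{w. x n + w *s b \<in> \<Omega>}" "\<lambda>w. p (x n + w *s b)", OF _ r])
        show "submean {w. x n + w *s b \<in> \<Omega>} (\<lambda>w. p (x n + w *s b))"
          using sub unfolding pluri_submean_def by blast
        show "cball 0 r \<subseteq> {w. x n + w *s b \<in> \<Omega>}" using near[OF xe] e by auto
        show "set_integrable lborel {0..2*pi} (\<lambda>t. max (q (x n + C t)) (q (z + C t)))"
          using intJ[of n] unfolding set_integrable_def J_def by simp
        fix t
        have "x n + C t \<in> \<Omega>" using near\<Omega>[OF xe] .
        from pq[OF this] show "p (x n + (0 + of_real r * cis t) *s b) \<le> max (q (x n + C t)) (q (z + C t))"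
          unfolding C_def by simp
      qed
      then have "2 * pi * p (x n) \<le> integral\<^sup>L lborel (J n)"
        unfolding set_lebesgue_integral_def J_def by simp
      moreover have "2 * pi * (q z - 1 / real (Suc n)) \<le> 2 * pi * p (x n)"
        using x(3)[of n] by (intro mult_left_mono) auto
      ultimately show "2 * pi * (q z - 1 / real (Suc n)) \<le> integral\<^sup>L lborel (J n)" by linarith
    qed
    moreover have "(\<lambda>n. 2 * pi * (q z - 1 / real (Suc n))) \<longlonglongrightarrow> 2 * pi * (q z - 0)"
      by (intro tendsto_intros LIMSEQ_Suc[OF lim_1_over_n])
    ultimately have "2 * pi * (q z - 0) \<le> integral\<^sup>L lborel I"
      using lim by (intro LIMSEQ_le[OF _ lim] exI)
    also have "integral\<^sup>L lborel I = (LINT t:{0..2*pi}|lborel. q (z + C t))"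
      unfolding set_lebesgue_integral_def I_def by simp
    also have "\<dots> \<le> (LINT t:{0..2*pi}|lborel. g t)"
      using qg aC e(1) by (intro set_integral_mono int0 g) auto
    finally show "2 * pi * q (a + c *s b) \<le> (LINT t:{0..2*pi}|lborel. g t)"
      unfolding z_def by simp
  qed
  with that usc pq qF show thesis by blast
qed

section \<open>The envelope\<close>

lemma integral_const_circle: "(LINT t:{0..2*pi}|lborel. (k::real)) = 2 * pi * k"
  using integral_quad_circle[of k 0 0 0 0 0] by (simp add: quad_def)

lemma set_integrable_const_circle: "set_integrable lborel {0..2*pi} (\<lambda>t. k::real)"
  by (intro borel_integrable_atLeastAtMost' continuous_on_const)

lemma submean_const: "submean D (\<lambda>z. k)"
  unfolding submean_def
proof (intro allI impI, elim conjE)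
  fix g assume "set_integrable lborel {0..2*pi} g" "\<forall>t\<in>{0..2*pi}. k \<le> g t"
  then have "(LINT t:{0..2*pi}|lborel. k) \<le> (LINT t:{0..2*pi}|lborel. g t)"
    by (intro set_integral_mono set_integrable_const_circle) auto
  then show "2 * pi * k \<le> (LINT t:{0..2*pi}|lborel. g t)" by (simp add: integral_const_circle)
qed

lemma submean_diff_const:
  assumes "submean D v"
  shows "submean D (\<lambda>z. v z - k)"
  unfolding submean_def
proof (intro allI impI, elim conjE)
  fix c r g assume *: "0 < r" "cball c r \<subseteq> D" and g: "set_integrable lborel {0..2*pi} g"
    and vg: "\<forall>t\<in>{0..2*pi}. v (c + of_real r * cis t) - k \<le> g t"
  have "2 * pi * v c \<le> (LINT t:{0..2*pi}|lborel. g t + k)"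
    using vg by (intro submeanD[OF assms *] set_integral_add(1) g set_integrable_const_circle)
      (auto simp: algebra_simps)
  also have "\<dots> = (LINT t:{0..2*pi}|lborel. g t) + 2 * pi * k"
    by (subst set_integral_add(2)[OF g set_integrable_const_circle]) (simp add: integral_const_circle)
  finally show "2 * pi * (v c - k) \<le> (LINT t:{0..2*pi}|lborel. g t)"
    by (simp add: algebra_simps)
qed

lemma psh_le_PB_envelope:
  assumes "psh_on \<Omega> u" "\<forall>w\<in>\<Omega>. usc_reg \<Omega> u w \<le> ereal (F w)"
  shows "u z \<le> PB_envelope \<Omega> F z"
  unfolding PB_envelope_def using assms by (intro Sup_upper) auto

text \<open>Criterion for real-valued competitors, applied to a constant, to the regularized
  envelope and to rotated copies of the envelope.\<close>

lemma submean_le_PB_envelope: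
  fixes f :: "complex ^ 'n \<Rightarrow> real"
  assumes "usc_on \<Omega> F" "usc_on \<Omega> f" "pluri_submean \<Omega> f"
    and "\<And>z. z \<in> \<Omega> \<Longrightarrow> m \<le> f z" "\<And>z. z \<in> \<Omega> \<Longrightarrow> f z \<le> F z"
  shows "ereal (f z) \<le> PB_envelope \<Omega> F z"
proof -
  have "psh_on \<Omega> (\<lambda>z. ereal (f z))" using assms by (intro psh_on_ereal)
  moreover have "usc_reg \<Omega> (\<lambda>z. ereal (f z)) w \<le> ereal (F w)" if "w \<in> \<Omega>" for w
    using usc_reg_le[of \<Omega> "\<lambda>z. ereal (F z)" "\<lambda>z. ereal (f z)"] assms that
    by (simp add: usc_on_ereal)
  ultimately show ?thesis by (intro psh_le_PB_envelope[of \<Omega> "\<lambda>z. ereal (f z)"]) auto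
qed

text \<open>A majorant of \<open>p\<close> on the circle majorizes every competitor, and the
  resulting bound at the centre does not depend on the competitor, so it passes to the
  supremum.\<close>

lemma PB_envelope_submean:
  assumes p: "\<And>z. z \<in> \<Omega> \<Longrightarrow> PB_envelope \<Omega> F z = ereal (p z)"
  shows "pluri_submean \<Omega> p"
  unfolding pluri_submean_def submean_def
proof (intro allI impI, elim conjE)
  fix a b c r g
  assume r: "0 < r" and D: "cball c r \<subseteq> {w. a + w *s b \<in> \<Omega>}"
    and g: "set_integrable lborel {0..2*pi} g"
    and pg: "\<forall>t\<in>{0..2*pi}. p (a + (c + of_real r * cis t) *s b) \<le> g t"
  let ?I = "(LINT t:{0..2*pi}|lborel. g t) / (2 * pi)"
  have "PB_envelope \<Omega> F (a + c *s b) \<le> ereal ?I"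
    unfolding PB_envelope_def
  proof (intro Sup_least, clarify)
    fix u assume u: "psh_on \<Omega> u" "\<forall>w\<in>\<Omega>. usc_reg \<Omega> u w \<le> ereal (F w)"
    have "u (a + c *s b) \<le> circle_mean (\<lambda>w. u (a + w *s b)) c r"
      using u(1) r D unfolding psh_on_def subharmonic_on_def by blast
    also have "\<dots> \<le> ereal ?I"
    proof (rule circle_mean_le[OF g])
      fix t :: real assume t: "t \<in> {0..2*pi}"
      have "c + of_real r * cis t \<in> {w. a + w *s b \<in> \<Omega>}"
        using r by (intro subsetD[OF D]) (simp add: dist_norm norm_mult)
      then have "u (a + (c + of_real r * cis t) *s b) \<le> ereal (p (a + (c + of_real r * cis t) *s b))"
        using psh_le_PB_envelope[OF u] p by (metis mem_Collect_eq)
      then show "u (a + (c + of_real r * cis t) *s b) \<le> ereal (g t)"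
        using pg t by (meson ereal_less_eq(3) order_trans)
    qed
    finally show "u (a + c *s b) \<le> ereal ?I" .
  qed
  moreover have "a + c *s b \<in> \<Omega>" using subsetD[OF D, of c] r by simp
  ultimately have "p (a + c *s b) \<le> ?I" using p by simp
  then show "2 * pi * p (a + c *s b) \<le> (LINT t:{0..2*pi}|lborel. g t)"
    by (simp add: field_simps)
qed

lemma PB_envelope_usc_psh:
  fixes F :: "complex ^ 'n \<Rightarrow> real"
  assumes "open \<Omega>" and F: "usc_on \<Omega> F" and mF: "\<And>z. z \<in> \<Omega> \<Longrightarrow> m \<le> F z"
  obtains p where "\<And>z. z \<in> \<Omega> \<Longrightarrow> PB_envelope \<Omega> F z = ereal (p z)"
    "usc_on \<Omega> p" "pluri_submean \<Omega> p"
    "\<And>z. z \<in> \<Omega> \<Longrightarrow> m \<le> p z" "\<And>z. z \<in> \<Omega> \<Longrightarrow> p z \<le> F z"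
proof -
  define p where "p z = real_of_ereal (PB_envelope \<Omega> F z)" for z
  have p: "PB_envelope \<Omega> F z = ereal (p z)" if "z \<in> \<Omega>" for z
  proof -
    have "bdd_below (F ` \<Omega>)" using mF by (auto intro!: bdd_belowI2)
    then show ?thesis
      using PB_envelope_finite[OF _ that] unfolding p_def by (simp add: ereal_real)
  qed
  have "PB_envelope \<Omega> F z \<le> ereal (F z)" if "z \<in> \<Omega>" for z
    unfolding PB_envelope_def
    by (rule Sup_least) (use that in \<open>auto intro: order_trans[OF usc_reg_ge]\<close>)
  then have pF: "p z \<le> F z" if "z \<in> \<Omega>" for z using that p by simp
  have "ereal m \<le> PB_envelope \<Omega> F z" for z
    by (rule submean_le_PB_envelope[OF F, where m = m])
      (auto simp: pluri_submean_def submean_const usc_on_def mF)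
  then have mp: "m \<le> p z" if "z \<in> \<Omega>" for z using that p by (metis ereal_less_eq(3))
  have sub: "pluri_submean \<Omega> p" using PB_envelope_submean[OF p] .
  obtain q where q: "usc_on \<Omega> q" "\<And>z. z \<in> \<Omega> \<Longrightarrow> p z \<le> q z" "\<And>z. z \<in> \<Omega> \<Longrightarrow> q z \<le> F z"
    "pluri_submean \<Omega> q"
    by (rule usc_regularization_submean[OF assms(1) F mp pF sub], assumption+, rule that)
  \<comment> \<open>The regularization is itself a competitor, hence no larger than the
    envelope.\<close>
  have "q z = p z" if z: "z \<in> \<Omega>" for z
  proof -
    have "ereal (q z) \<le> PB_envelope \<Omega> F z"
      using q mp by (intro submean_le_PB_envelope[OF F, where m = m]) (auto intro: order_trans)
    then show ?thesis using p[OF z] q(2)[OF z] by simp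
  qed
  then have "usc_on \<Omega> p" using q(1) unfolding usc_on_iff_open by simp
  with that p sub mp pF show thesis by blast
qed

section \<open>Toric rotations of the envelope\<close>

lemma toric_act_continuous: "continuous_on S (toric_act \<tau>)"
  unfolding toric_act_def by (intro continuous_intros)

text \<open>Rotations are linear, so complex lines go to complex lines with the same parameter and
  the submean property survives composition.\<close>

lemma toric_act_line: "toric_act \<tau> (a + w *s b) = toric_act \<tau> a + w *s toric_act \<tau> b"
  by (simp add: toric_act_def vec_eq_iff algebra_simps)

lemma PB_envelope_toric_modulus:
  fixes F :: "complex ^ 'n \<Rightarrow> real"
  assumes inv: "toric_invariant \<Omega>" and F: "usc_on \<Omega> F"
    and uc: "torically_uniformly_continuous_on \<Omega> F"
    and p: "\<And>z. z \<in> \<Omega> \<Longrightarrow> PB_envelope \<Omega> F z = ereal (p z)" "usc_on \<Omega> p" "pluri_submean \<Omega> p"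
      "\<And>z. z \<in> \<Omega> \<Longrightarrow> m \<le> p z" "\<And>z. z \<in> \<Omega> \<Longrightarrow> p z \<le> F z"
    and "\<epsilon> > 0"
  obtains \<delta> where "\<delta> > 0"
    "\<And>z \<tau>. z \<in> \<Omega> \<Longrightarrow> \<tau> \<in> torus \<Longrightarrow> dist \<tau> (\<chi> i. 1) < \<delta> \<Longrightarrow> p (toric_act \<tau> z) \<le> p z + \<epsilon>"
proof -
  have one: "(\<chi> i. 1) \<in> torus" "toric_act (\<chi> i. 1) z = z" for z :: "complex ^ 'n"
    by (auto simp: torus_def toric_act_def vec_eq_iff)
  have eq: "\<forall>x\<in>torus. \<forall>\<epsilon>>0. \<exists>\<delta>>0. \<forall>f\<in>(\<lambda>z \<tau>. F (toric_act \<tau> z)) ` \<Omega>. \<forall>\<tau>\<in>torus.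
      dist \<tau> x < \<delta> \<longrightarrow> dist (f \<tau>) (f x) < \<epsilon>"
    using uc unfolding torically_uniformly_continuous_on_def equicontinuous_on_def .
  \<comment> \<open>Equicontinuity at the identity of the torus: \<delta> is the same for all points
    of \<Omega>.\<close>
  obtain \<delta> where "\<delta> > 0" and "\<forall>f\<in>(\<lambda>z \<tau>. F (toric_act \<tau> z)) ` \<Omega>. \<forall>\<tau>\<in>torus.
      dist \<tau> (\<chi> i. 1) < \<delta> \<longrightarrow> dist (f \<tau>) (f (\<chi> i. 1)) < \<epsilon>"
    using bspec[OF eq one(1), rule_format, OF \<open>\<epsilon> > 0\<close>] by (elim exE conjE) (rule that)
  then have \<delta>: "\<delta> > 0"
    "\<And>z \<tau>. z \<in> \<Omega> \<Longrightarrow> \<tau> \<in> torus \<Longrightarrow> dist \<tau> (\<chi> i. 1) < \<delta> \<Longrightarrow> dist (F (toric_act \<tau> z)) (F z) < \<epsilon>"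
    by (simp_all add: one(2))
  have "p (toric_act \<tau> z) \<le> p z + \<epsilon>"
    if z: "z \<in> \<Omega>" and \<tau>: "\<tau> \<in> torus" "dist \<tau> (\<chi> i. 1) < \<delta>" for z \<tau>
  proof -
    have act: "toric_act \<tau> w \<in> \<Omega>" if "w \<in> \<Omega>" for w
      using inv \<tau>(1) that unfolding toric_invariant_def by blast
    have Fact: "F (toric_act \<tau> w) < F w + \<epsilon>" if "w \<in> \<Omega>" for w
    proof -
      have "dist (F (toric_act \<tau> w)) (F w) < \<epsilon>" using \<delta>(2)[OF that \<tau>] .
      then show ?thesis unfolding dist_real_def by linarith
    qed
    have "ereal (p (toric_act \<tau> z) - \<epsilon>) \<le> PB_envelope \<Omega> F z"
    proof (rule submean_le_PB_envelope[OF F, of "\<lambda>z. p (toric_act \<tau> z) - \<epsilon>"])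
      show "usc_on \<Omega> (\<lambda>z. p (toric_act \<tau> z) - \<epsilon>)"
        by (intro usc_on_diff_continuous usc_on_compose[OF p(2)] toric_act_continuous continuous_on_const)
          (use act in auto)
      show "pluri_submean \<Omega> (\<lambda>z. p (toric_act \<tau> z) - \<epsilon>)"
        unfolding pluri_submean_def toric_act_line
      proof (intro allI submean_diff_const)
        fix a b
        have "submean {w. toric_act \<tau> a + w *s toric_act \<tau> b \<in> \<Omega>} (\<lambda>w. p (toric_act \<tau> a + w *s toric_act \<tau> b))"
          using p(3) unfolding pluri_submean_def by blast
        then show "submean {w. a + w *s b \<in> \<Omega>} (\<lambda>w. p (toric_act \<tau> a + w *s toric_act \<tau> b))"
          by (rule submean_subset) (use act in \<open>auto simp flip: toric_act_line\<close>)
      qed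
      fix w assume w: "w \<in> \<Omega>"
      show "m - \<epsilon> \<le> p (toric_act \<tau> w) - \<epsilon>" using p(4)[OF act[OF w]] by simp
      show "p (toric_act \<tau> w) - \<epsilon> \<le> F w" using p(5)[OF act[OF w]] Fact[OF w] by simp
    qed
    then show ?thesis using p(1)[OF z] by simp
  qed
  with \<delta>(1) that show thesis by blast
qed

section \<open>Lower semicontinuity, one coordinate at a time\<close>

definition upd :: "complex ^ 'n \<Rightarrow> 'n \<Rightarrow> complex \<Rightarrow> complex ^ 'n" where
  "upd z j x = (\<chi> i. if i = j then x else z $ i)"

text \<open>Varying one coordinate is moving along a complex line; the scale \<omega> is free, so a
  chosen circle can be made the unit circle.\<close>

lemma upd_line: "upd z j (\<omega> * \<zeta>) = upd z j 0 + \<zeta> *s axis j \<omega>"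
  by (simp add: upd_def axis_def vec_eq_iff)

lemma upd_same: "upd z j (z $ j) = z"
  by (simp add: upd_def vec_eq_iff)

lemma dist_upd_le:
  assumes "norm (x - a $ j) \<le> norm (w $ j - a $ j)"
  shows "dist (upd w j x) a \<le> dist w a"
  unfolding dist_norm using assms by (intro norm_le_componentwise_cart) (simp add: upd_def)

lemma dist_upd_self: "dist (upd w j x) w \<le> norm (x - w $ j)"
proof -
  have "upd w j x - w = axis j (x - w $ j)" by (simp add: upd_def axis_def vec_eq_iff)
  then show ?thesis by (simp add: dist_norm norm_eq_sqrt_inner[of "axis _ _"] inner_axis_axis norm_eq_sqrt_inner)
qed

text \<open>The conclusion trades a tolerance \<epsilon>' after resetting coordinate
  \<open>j\<close> for the tolerance \<epsilon> before, which is the form an induction over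
  coordinates consumes.\<close>

lemma coordinate_step_zero:
  fixes p :: "complex ^ 'n \<Rightarrow> real"
  assumes \<Omega>: "open \<Omega>" "a \<in> \<Omega>" and usc: "usc_on \<Omega> p" and sub: "pluri_submean \<Omega> p"
    and rot: "\<delta> > 0" "\<And>w \<tau>. w \<in> \<Omega> \<Longrightarrow> norm \<tau> = 1 \<Longrightarrow> norm (\<tau> - 1) < \<delta> \<Longrightarrow>
        p (upd w j (\<tau> * w $ j)) \<le> p w + \<epsilon> / 2"
    and "\<epsilon> > 0" and a0: "a $ j = 0"
  shows "\<exists>\<epsilon>'>0. \<exists>\<eta>>0. \<forall>w. dist w a < \<eta> \<longrightarrow> p a - \<epsilon>' \<le> p (upd w j (a $ j)) \<longrightarrow> p a - \<epsilon> \<le> p w"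
proof -
  have "continuous_on UNIV cis" by (intro continuous_intros)
  then have "\<exists>d>0. \<forall>t\<in>UNIV. dist t 0 < d \<longrightarrow> dist (cis t) (cis 0) < \<delta>"
    using rot(1) unfolding continuous_on_iff by blast
  then obtain d0 where d0: "d0 > 0" "\<And>t. \<bar>t\<bar> < d0 \<Longrightarrow> norm (cis t - 1) < \<delta>"
    by (auto simp: dist_norm)
  \<comment> \<open>Halving makes the closed arc satisfy the strict bound; the cap 1 keeps it within
    a single turn.\<close>
  define d where "d = min (d0 / 2) 1"
  have d: "0 < d" "d \<le> 2 * pi" "\<And>t. t \<in> {0..d} \<Longrightarrow> norm (cis t - 1) < \<delta>"
    using d0 pi_gt3 by (auto simp: d_def)
  \<comment> \<open>Makes the oscillation 4 pi \<epsilon>' equal to the deficit d \<epsilon> / 2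
    contributed by the arc; the extra term d \<epsilon>' then gives the contradiction.\<close>
  define \<epsilon>' where "\<epsilon>' = d * \<epsilon> / (8 * pi)"
  have \<epsilon>': "\<epsilon>' > 0" using d \<open>\<epsilon> > 0\<close> by (simp add: \<epsilon>'_def)
  obtain e1 where e1: "e1 > 0" "ball a e1 \<subseteq> \<Omega>" using \<Omega> open_contains_ball by blast
  obtain e2 where e2: "e2 > 0" "\<And>w. w \<in> \<Omega> \<Longrightarrow> dist w a < e2 \<Longrightarrow> p w < p a + \<epsilon>'"
    using usc_on_dist[OF usc \<Omega>(2), of "p a + \<epsilon>'"] \<epsilon>' by auto
  have "p a - \<epsilon> \<le> p w" if w: "dist w a < min e1 e2" and lower: "p a - \<epsilon>' \<le> p (upd w j 0)" for w
  proof (rule ccontr)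
    assume "\<not> p a - \<epsilon> \<le> p w"
    then have low: "p w + \<epsilon> / 2 \<le> p a - \<epsilon> / 2" by simp
    define b where "b = axis j (w $ j)"
    have line: "upd w j 0 + \<zeta> *s b = upd w j (\<zeta> * w $ j)" for \<zeta>
      unfolding b_def upd_line[symmetric] by (simp add: mult.commute)
    have near: "dist (upd w j (\<zeta> * w $ j)) a < min e1 e2" if "norm \<zeta> \<le> 1" for \<zeta>
    proof -
      \<comment> \<open>Since a_j = 0, shrinking coordinate \<open>j\<close> does not increase the
        distance to \<open>a\<close>, so the whole disc stays near \<open>a\<close>.\<close>
      have "dist (upd w j (\<zeta> * w $ j)) a \<le> dist w a"
        using that by (intro dist_upd_le) (simp add: a0 norm_mult mult_left_le_one_le)
      with w show ?thesis by linarith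
    qed
    have in\<Omega>: "upd w j (\<zeta> * w $ j) \<in> \<Omega>" if "norm \<zeta> \<le> 1" for \<zeta>
      using near[OF that] e1(2) by (auto simp: dist_commute)
    \<comment> \<open>The majorant is p a + \<epsilon>' off the arc and p a - \<epsilon> / 2 on
      it.\<close>
    define g where "g t = p a + \<epsilon>' - indicator {0..d} t * (\<epsilon> / 2 + \<epsilon>')" for t
    have int: "set_integrable lborel {0..2*pi} (\<lambda>t. indicator {0..d} t * (\<epsilon> / 2 + \<epsilon>'))"
      and val: "(LINT t:{0..2*pi}|lborel. indicator {0..d} t * (\<epsilon> / 2 + \<epsilon>')) = d * (\<epsilon> / 2 + \<epsilon>')"
    proof -
      have *: "indicator {0..2*pi} t *\<^sub>R (indicator {0..d} t * (\<epsilon> / 2 + \<epsilon>'))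
        = indicator {0..d} t *\<^sub>R (\<epsilon> / 2 + \<epsilon>')" for t
        using d by (auto simp: indicator_def)
      show "set_integrable lborel {0..2*pi} (\<lambda>t. indicator {0..d} t * (\<epsilon> / 2 + \<epsilon>'))"
        unfolding set_integrable_def *
        using borel_integrable_atLeastAtMost'[of 0 d "\<lambda>t. \<epsilon> / 2 + \<epsilon>'"] by (simp add: set_integrable_def)
      show "(LINT t:{0..2*pi}|lborel. indicator {0..d} t * (\<epsilon> / 2 + \<epsilon>')) = d * (\<epsilon> / 2 + \<epsilon>')"
        unfolding set_lebesgue_integral_def * using d by simp
    qed
    have "2 * pi * p (upd w j 0 + 0 *s b) \<le> (LINT t:{0..2*pi}|lborel. g t)"
    proof (rule submeanD[of "{w'. upd w j 0 + w' *s b \<in> \<Omega>}" "\<lambda>w'. p (upd w j 0 + w' *s b)" 1])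
      show "submean {w'. upd w j 0 + w' *s b \<in> \<Omega>} (\<lambda>w'. p (upd w j 0 + w' *s b))"
        using sub unfolding pluri_submean_def by blast
      show "cball 0 1 \<subseteq> {w'. upd w j 0 + w' *s b \<in> \<Omega>}" unfolding line using in\<Omega> by auto
      show "set_integrable lborel {0..2*pi} g" unfolding g_def
        by (intro set_integral_diff(1) set_integrable_const_circle int)
      fix t
      show "p (upd w j 0 + (0 + of_real 1 * cis t) *s b) \<le> g t"
      proof (cases "t \<in> {0..d}")
        case True
        have "w \<in> \<Omega>" using in\<Omega>[of 1] by (simp add: upd_same)
        then have "p (upd w j (cis t * w $ j)) \<le> p w + \<epsilon> / 2" using d(3)[OF True] by (intro rot(2)) auto
        then show ?thesis using low True unfolding line g_def by simp
      next
        case False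
        then show ?thesis using e2(2)[of "upd w j (cis t * w $ j)"] near[of "cis t"] in\<Omega>[of "cis t"]
          unfolding line g_def by simp
      qed
    qed simp
    also have "\<dots> = 2 * pi * (p a + \<epsilon>') - d * (\<epsilon> / 2 + \<epsilon>')"
      unfolding g_def set_integral_diff(2)[OF set_integrable_const_circle int]
        integral_const_circle val ..
    finally have "2 * pi * p (upd w j 0) \<le> 2 * pi * (p a + \<epsilon>') - d * (\<epsilon> / 2 + \<epsilon>')" by simp
    moreover have "2 * pi * (p a - \<epsilon>') \<le> 2 * pi * p (upd w j 0)"
      using lower by (intro mult_left_mono) auto
    ultimately have "2 * pi * (p a - \<epsilon>') \<le> 2 * pi * (p a + \<epsilon>') - d * (\<epsilon> / 2 + \<epsilon>')" by linarith
    then have "d * \<epsilon> / 2 + d * \<epsilon>' \<le> 4 * pi * \<epsilon>'" by (simp add: algebra_simps)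
    moreover have "4 * pi * \<epsilon>' = d * \<epsilon> / 2" by (simp add: \<epsilon>'_def)
    moreover have "d * \<epsilon>' > 0" using d \<epsilon>' by simp
    ultimately show False by linarith
  qed
  then show ?thesis unfolding a0 using \<epsilon>' e1(1) e2(1) by (intro exI[of _ \<epsilon>'] conjI exI[of _ "min e1 e2"]) auto
qed

text \<open>The barrier estimate is used on a disc of fixed relative size \<rho>, with M = p w +
  \<epsilon> / 2 and an error proportional to |c - 1|, which is small for \<open>w\<close> near
  \<open>a\<close>. With \<epsilon>' = \<epsilon> / 4 the losses add up to \<epsilon>.\<close>

lemma coordinate_step_nonzero:
  fixes p :: "complex ^ 'n \<Rightarrow> real"
  assumes \<Omega>: "open \<Omega>" "a \<in> \<Omega>" and usc: "usc_on \<Omega> p" and sub: "pluri_submean \<Omega> p"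
    and m: "\<And>z. z \<in> \<Omega> \<Longrightarrow> m \<le> p z"
    and rot: "\<delta> > 0" "\<And>w \<tau>. w \<in> \<Omega> \<Longrightarrow> norm \<tau> = 1 \<Longrightarrow> norm (\<tau> - 1) < \<delta> \<Longrightarrow>
        p (upd w j (\<tau> * w $ j)) \<le> p w + \<epsilon> / 2"
    and "\<epsilon> > 0" and a0: "a $ j \<noteq> 0"
  shows "\<exists>\<epsilon>'>0. \<exists>\<eta>>0. \<forall>w. dist w a < \<eta> \<longrightarrow> p a - \<epsilon>' \<le> p (upd w j (a $ j)) \<longrightarrow> p a - \<epsilon> \<le> p w"
proof -
  define \<alpha> s where "\<alpha> = a $ j" and "s = norm \<alpha>"
  have s: "s > 0" using a0 by (simp add: s_def \<alpha>_def)
  obtain e1 where e1: "e1 > 0" "ball a e1 \<subseteq> \<Omega>" using \<Omega> open_contains_ball by blast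
  obtain e2 where e2: "e2 > 0" "\<And>w. w \<in> \<Omega> \<Longrightarrow> dist w a < e2 \<Longrightarrow> p w < p a + 1"
    using usc_on_dist[OF usc \<Omega>(2), of "p a + 1"] by auto
  define e where "e = min e1 e2"
  have e: "e > 0" "\<And>w. dist w a < e \<Longrightarrow> w \<in> \<Omega>" "\<And>w. dist w a < e \<Longrightarrow> p w \<le> p a + 1"
    using e1 e2 by (auto simp: e_def dist_commute subset_eq intro: less_imp_le)
  define L where "L = p a + 1 - m"
  have L: "L > 0" using m[OF \<Omega>(2)] by (simp add: L_def)
  \<comment> \<open>The entries serve the barrier lemma, keep the disc in the ball of radius
    \<open>e\<close>, and use half of the allowed rotation.\<close>
  define \<rho> where "\<rho> = Min {1/4, e / (4 * s), \<delta> / 2}"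
  have \<rho>: "\<rho> > 0" "\<rho> \<le> 1/4" "\<rho> \<le> e / (4 * s)" "\<rho> \<le> \<delta> / 2"
    using e(1) s rot(1) by (auto simp: \<rho>_def)
  \<comment> \<open>In order: stay in the ball, keep |w_j| comparable to \<open>s\<close>, use the
    other half of the rotation, get |c - 1| \<le> \<rho>, and make the barrier error at most
    \<epsilon> / 4.\<close>
  define \<eta> where "\<eta> = Min {e / 8, s / 2, \<delta> * s / 8, \<rho> * s / 2, \<epsilon> * \<rho>\<^sup>2 * s / (96 * L)}"
  have "\<eta> > 0" unfolding \<eta>_def
    using e(1) s rot(1) \<rho>(1) L \<open>\<epsilon> > 0\<close> by (subst Min_gr_iff) auto
  moreover have "\<eta> \<le> e / 8" "\<eta> \<le> s / 2" "\<eta> \<le> \<delta> * s / 8" "\<eta> \<le> \<rho> * s / 2"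
    "\<eta> \<le> \<epsilon> * \<rho>\<^sup>2 * s / (96 * L)"
    unfolding \<eta>_def by (rule Min_le; simp)+
  ultimately have \<eta>: "\<eta> > 0" "\<eta> \<le> e / 8" "\<eta> \<le> s / 2" "\<eta> \<le> \<delta> * s / 8" "\<eta> \<le> \<rho> * s / 2"
    "\<eta> \<le> \<epsilon> * \<rho>\<^sup>2 * s / (96 * L)" .
  have "p a - \<epsilon> \<le> p w" if w: "dist w a < \<eta>" and lower: "p a - \<epsilon> / 4 \<le> p (upd w j \<alpha>)" for w
  proof -
    have w\<Omega>: "w \<in> \<Omega>" using w \<eta>(2) e(1) by (intro e(2)) linarith
    have diff: "norm (w $ j - \<alpha>) < \<eta>"
      using w Finite_Cartesian_Product.norm_nth_le[of "w - a" j]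
      by (simp add: dist_norm \<alpha>_def)
    then have ndiff: "\<bar>norm (w $ j) - s\<bar> < \<eta>"
      unfolding s_def using norm_triangle_ineq3[of "w $ j" \<alpha>] by linarith
    \<comment> \<open>In the coordinate \<open>\<zeta>\<close> with \<open>z\<^sub>j = \<omega> \<zeta>\<close> the circle through \<open>w\<^sub>j\<close> is the unit circle and \<open>a\<^sub>j\<close> is the
      positive real number \<open>c\<close>.\<close>
    define t where "t = norm (w $ j)"
    have t: "s / 2 \<le> t" "t \<le> 3/2 * s" "t > 0" using ndiff \<eta>(3) s by (auto simp: t_def)
    \<comment> \<open>The modulus is that of w_j, the argument that of a_j; hence the parameter 1 is
      within 2 \<eta> of w_j.\<close>
    define \<omega> where "\<omega> = of_real (t / s) * \<alpha>"
    have n\<omega>: "norm \<omega> = t"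
    proof -
      have "norm \<omega> = \<bar>t / s\<bar> * s"
        unfolding \<omega>_def by (simp only: norm_mult norm_of_real s_def[symmetric])
      then show ?thesis using s t by simp
    qed
    have "\<omega> - \<alpha> = of_real (t / s - 1) * \<alpha>" by (simp add: \<omega>_def algebra_simps)
    then have "norm (\<omega> - \<alpha>) = \<bar>t / s - 1\<bar> * s"
      by (simp only: norm_mult norm_of_real s_def[symmetric])
    also have "\<dots> = \<bar>(t / s - 1) * s\<bar>" using s by (simp add: abs_mult)
    also have "(t / s - 1) * s = t - s" using s by (simp add: field_simps)
    finally have "norm (\<omega> - \<alpha>) < \<eta>" using ndiff by (simp add: t_def)
    then have \<omega>w: "norm (\<omega> - w $ j) < 2 * \<eta>"
      using diff norm_triangle_ineq4[of "\<omega> - \<alpha>" "w $ j - \<alpha>"] by simp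
    define c where "c = s / t"
    have c\<alpha>: "\<omega> * of_real c = \<alpha>" using s t by (simp add: \<omega>_def c_def)
    have "c - 1 = (s - t) / t" using t by (simp add: c_def field_simps)
    then have "\<bar>c - 1\<bar> = \<bar>t - s\<bar> / t" using t by (simp add: abs_minus_commute)
    also have "\<dots> \<le> \<eta> / (s / 2)" using ndiff t s by (intro frac_le) (auto simp: t_def)
    finally have c: "\<bar>c - 1\<bar> \<le> 2 * \<eta> / s" by (simp add: mult.commute)
    define b where "b = axis j \<omega>"
    have line: "upd w j 0 + \<zeta> *s b = upd w j (\<omega> * \<zeta>)" for \<zeta> unfolding b_def upd_line ..
    have near: "dist (upd w j (\<omega> * \<zeta>)) a < e" if "\<zeta> \<in> cball 1 \<rho>" for \<zeta>
    proof -
      have "norm (\<omega> * \<zeta> - w $ j) = norm (\<omega> * (\<zeta> - 1) + (\<omega> - w $ j))" by (simp add: algebra_simps)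
      also have "\<dots> \<le> t * norm (\<zeta> - 1) + norm (\<omega> - w $ j)"
        by (metis n\<omega> norm_mult norm_triangle_ineq)
      also have "t * norm (\<zeta> - 1) \<le> (3/2 * s) * \<rho>"
        using that t s by (intro mult_mono) (auto simp: dist_norm norm_minus_commute)
      also have "(3/2 * s) * \<rho> \<le> (3/2 * s) * (e / (4 * s))" using \<rho> s by (intro mult_left_mono) auto
      also have "\<dots> = 3/8 * e" using s by simp
      finally have "dist (upd w j (\<omega> * \<zeta>)) w < 3/8 * e + 2 * \<eta>"
        using dist_upd_self[of w j "\<omega> * \<zeta>"] \<omega>w by linarith
      then show ?thesis using dist_triangle[of "upd w j (\<omega> * \<zeta>)" a w] w \<eta>(2) e(1) by linarith
    qed
    have "p (upd w j 0 + of_real c *s b) \<le> (p w + \<epsilon> / 2) + 12 * L / \<rho>\<^sup>2 * \<bar>c - 1\<bar>"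
    proof (rule center_bound_by_arc[OF \<rho>(1,2) _ L, where v = "\<lambda>\<zeta>. p (upd w j 0 + \<zeta> *s b)"])
      have "2 * \<eta> / s \<le> \<rho>" using \<eta>(5) s by (simp add: field_simps)
      then show "\<bar>c - 1\<bar> \<le> \<rho>" using c by linarith
      have in\<Omega>: "cball 1 \<rho> \<subseteq> {\<zeta>. upd w j 0 + \<zeta> *s b \<in> \<Omega>}" unfolding line using near e(2) by auto
      show "usc_on (cball 1 \<rho>) (\<lambda>\<zeta>. p (upd w j 0 + \<zeta> *s b))"
        using usc_on_subset[OF usc_on_line[OF usc] in\<Omega>] .
      show "submean (cball 1 \<rho>) (\<lambda>\<zeta>. p (upd w j 0 + \<zeta> *s b))"
        using sub in\<Omega> submean_subset unfolding pluri_submean_def by blast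
      fix \<zeta> assume \<zeta>: "\<zeta> \<in> cball (1::complex) \<rho>"
      show "p (upd w j 0 + \<zeta> *s b) \<le> (p w + \<epsilon> / 2) + L"
        using e(3)[OF near[OF \<zeta>]] m[OF w\<Omega>] \<open>\<epsilon> > 0\<close> unfolding line L_def by simp
      assume n\<zeta>: "norm \<zeta> = 1"
      \<comment> \<open>The rotation taking w_j to \<omega> \<zeta>. Its distance to 1 is at most
        |\<zeta> - 1| + |\<omega> - w_j| / t, each summand at most \<delta> / 2.\<close>
      define \<tau> where "\<tau> = \<omega> * \<zeta> / w $ j"
      have wj: "w $ j \<noteq> 0" using t(3) by (auto simp: t_def)
      have "norm \<tau> = 1" using n\<omega> n\<zeta> t(3) by (simp add: \<tau>_def norm_mult norm_divide t_def)
      moreover have "norm (\<tau> - 1) < \<delta>"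
      proof -
        have "\<tau> - 1 = \<omega> / w $ j * (\<zeta> - 1) + (\<omega> - w $ j) / w $ j"
          using wj by (simp add: \<tau>_def field_simps)
        then have "norm (\<tau> - 1) \<le> norm (\<omega> / w $ j * (\<zeta> - 1)) + norm ((\<omega> - w $ j) / w $ j)"
          using norm_triangle_ineq by metis
        also have "norm (\<omega> / w $ j * (\<zeta> - 1)) = norm (\<zeta> - 1)"
          using n\<omega> t(3) by (simp add: norm_mult norm_divide t_def)
        also have "norm (\<zeta> - 1) \<le> \<delta> / 2" using \<zeta> \<rho>(4) by (simp add: dist_norm norm_minus_commute)
        also have "norm ((\<omega> - w $ j) / w $ j) = norm (\<omega> - w $ j) / t" by (simp add: norm_divide t_def)
        also have "norm (\<omega> - w $ j) / t < 2 * \<eta> / (s / 2)"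
          using \<omega>w t s by (intro frac_less) auto
        also have "2 * \<eta> / (s / 2) \<le> \<delta> / 2" using \<eta>(4) s by (simp add: field_simps)
        finally show ?thesis by simp
      qed
      ultimately have "p (upd w j (\<tau> * w $ j)) \<le> p w + \<epsilon> / 2" by (rule rot(2)[OF w\<Omega>])
      then show "p (upd w j 0 + \<zeta> *s b) \<le> p w + \<epsilon> / 2" unfolding line using wj by (simp add: \<tau>_def)
    qed
    moreover have "12 * L / \<rho>\<^sup>2 * \<bar>c - 1\<bar> \<le> \<epsilon> / 4"
    proof -
      have "12 * L / \<rho>\<^sup>2 * \<bar>c - 1\<bar> \<le> 12 * L / \<rho>\<^sup>2 * (2 * (\<epsilon> * \<rho>\<^sup>2 * s / (96 * L)) / s)"
        using c \<eta>(6) L s \<rho>(1) by (intro mult_left_mono order_trans[OF c] divide_right_mono) auto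
      also have "\<dots> = \<epsilon> / 4" using L s \<rho>(1) by simp
      finally show ?thesis .
    qed
    ultimately show ?thesis using lower unfolding line c\<alpha> by linarith
  qed
  then show ?thesis unfolding \<alpha>_def using \<open>\<epsilon> > 0\<close> \<eta>(1)
    by (intro exI[of _ "\<epsilon> / 4"] conjI exI[of _ \<eta>]) auto
qed

text \<open>Induction on the set of coordinates in which \<open>w\<close> may differ from
  \<open>a\<close>. Resetting one of them brings the point no farther from \<open>a\<close>, and the
  induction hypothesis is used with the smaller tolerance requested by \<open>step\<close>.\<close>

lemma lower_semicontinuous_by_coordinates:
  fixes p :: "complex ^ 'n \<Rightarrow> real"
  assumes step: "\<And>j \<epsilon>. \<epsilon> > 0 \<Longrightarrow>
      \<exists>\<epsilon>'>0. \<exists>\<eta>>0. \<forall>w. dist w a < \<eta> \<longrightarrow> p a - \<epsilon>' \<le> p (upd w j (a $ j)) \<longrightarrow> p a - \<epsilon> \<le> p w"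
    and "finite J" and "\<epsilon> > 0"
  shows "\<exists>\<eta>>0. \<forall>w. dist w a < \<eta> \<longrightarrow> (\<forall>i. i \<notin> J \<longrightarrow> w $ i = a $ i) \<longrightarrow> p a - \<epsilon> \<le> p w"
  using \<open>finite J\<close> \<open>\<epsilon> > 0\<close>
proof (induction J arbitrary: \<epsilon> rule: finite_induct)
  case empty
  then have "p a - \<epsilon> \<le> p w" if "\<forall>i. w $ i = a $ i" for w
    using that by (simp flip: vec_eq_iff)
  then show ?case by (intro exI[of _ 1]) auto
next
  case (insert j J)
  obtain \<epsilon>' \<eta>1 where 1: "\<epsilon>' > 0" "\<eta>1 > 0"
    "\<And>w. dist w a < \<eta>1 \<Longrightarrow> p a - \<epsilon>' \<le> p (upd w j (a $ j)) \<Longrightarrow> p a - \<epsilon> \<le> p w"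
    using step[OF insert.prems] by blast
  obtain \<eta>2 where 2: "\<eta>2 > 0"
    "\<And>w. dist w a < \<eta>2 \<Longrightarrow> (\<forall>i. i \<notin> J \<longrightarrow> w $ i = a $ i) \<Longrightarrow> p a - \<epsilon>' \<le> p w"
    using insert.IH[OF 1(1)] by blast
  have "p a - \<epsilon> \<le> p w"
    if w: "dist w a < min \<eta>1 \<eta>2" "\<forall>i. i \<notin> insert j J \<longrightarrow> w $ i = a $ i" for w
  proof (rule 1(3))
    have "dist (upd w j (a $ j)) a \<le> dist w a" by (rule dist_upd_le) simp
    then show "p a - \<epsilon>' \<le> p (upd w j (a $ j))"
      using w by (intro 2(2)) (auto simp: upd_def)
  qed (use w in simp)
  then show ?case using 1(2) 2(1) by (intro exI[of _ "min \<eta>1 \<eta>2"]) auto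
qed

theorem theorem3p1:
  fixes \<Omega> :: "(complex ^ 'n) set" and F :: "complex ^ 'n \<Rightarrow> real"
  assumes "Reinhardt_domain \<Omega>"
    and "usc_on \<Omega> F"
    and "torically_uniformly_continuous_on \<Omega> F"
    and "bdd_below (F ` \<Omega>)"
  shows "continuous_on \<Omega> (PB_envelope \<Omega> F)"
proof -
  have \<Omega>: "open \<Omega>" "toric_invariant \<Omega>" using assms(1) by (auto simp: Reinhardt_domain_def)
  obtain m where m: "\<And>z. z \<in> \<Omega> \<Longrightarrow> m \<le> F z" using assms(4) by (auto simp: bdd_below_def)
  obtain p where p: "\<And>z. z \<in> \<Omega> \<Longrightarrow> PB_envelope \<Omega> F z = ereal (p z)"
    "usc_on \<Omega> p" "pluri_submean \<Omega> p"
    "\<And>z. z \<in> \<Omega> \<Longrightarrow> m \<le> p z" "\<And>z. z \<in> \<Omega> \<Longrightarrow> p z \<le> F z"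
    by (rule PB_envelope_usc_psh[OF \<Omega>(1) assms(2) m], assumption, rule that)
  have rot: "\<exists>\<delta>>0. \<forall>w \<tau>. w \<in> \<Omega> \<longrightarrow> norm \<tau> = 1 \<longrightarrow> norm (\<tau> - 1) < \<delta> \<longrightarrow>
      p (upd w j (\<tau> * w $ j)) \<le> p w + \<epsilon>" if pos: "\<epsilon> > 0" for \<epsilon> j
  proof -
    obtain \<delta> where \<delta>: "\<delta> > 0" "\<And>z \<tau>. z \<in> \<Omega> \<Longrightarrow> \<tau> \<in> torus \<Longrightarrow> dist \<tau> (\<chi> i. 1) < \<delta> \<Longrightarrow>
        p (toric_act \<tau> z) \<le> p z + \<epsilon>"
      by (rule PB_envelope_toric_modulus[OF \<Omega>(2) assms(2,3) p pos], assumption+, rule that)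
    have "p (upd w j (\<tau> * w $ j)) \<le> p w + \<epsilon>"
      if w: "w \<in> \<Omega>" and \<tau>: "norm \<tau> = 1" "norm (\<tau> - 1) < \<delta>" for w \<tau>
    proof -
      \<comment> \<open>Rotating a single coordinate is the toric action of an element with all
        other entries 1.\<close>
      have "upd w j (\<tau> * w $ j) = toric_act (upd (\<chi> i. 1) j \<tau>) w"
        by (simp add: upd_def toric_act_def vec_eq_iff)
      moreover have "upd (\<chi> i. 1) j \<tau> \<in> torus" using \<tau>(1) by (simp add: torus_def upd_def)
      moreover have "dist (upd (\<chi> i. 1) j \<tau>) (\<chi> i. 1) < \<delta>"
        using dist_upd_self[of "\<chi> i. 1" j \<tau>] \<tau>(2) by simp
      ultimately show ?thesis using \<delta>(2)[OF w] by simp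
    qed
    then show ?thesis using \<delta>(1) by blast
  qed
  have lower: "\<exists>\<eta>>0. \<forall>w. dist w a < \<eta> \<longrightarrow> p a - \<epsilon> \<le> p w" if a: "a \<in> \<Omega>" and "\<epsilon> > 0" for a \<epsilon>
  proof -
    have "\<exists>\<epsilon>'>0. \<exists>\<eta>>0. \<forall>w. dist w a < \<eta> \<longrightarrow> p a - \<epsilon>' \<le> p (upd w j (a $ j)) \<longrightarrow> p a - \<epsilon> \<le> p w"
      if \<epsilon>: "\<epsilon> > 0" for j \<epsilon>
    proof -
      obtain \<delta> where \<delta>: "\<delta> > 0" "\<And>w \<tau>. w \<in> \<Omega> \<Longrightarrow> norm \<tau> = 1 \<Longrightarrow> norm (\<tau> - 1) < \<delta> \<Longrightarrow>
          p (upd w j (\<tau> * w $ j)) \<le> p w + \<epsilon> / 2"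
        using rot[of "\<epsilon> / 2" j] \<epsilon> by (metis half_gt_zero)
      show ?thesis
      proof (cases "a $ j = 0")
        case True
        show ?thesis by (rule coordinate_step_zero[OF \<Omega>(1) a p(2,3) \<delta> \<epsilon> True])
      next
        case False
        show ?thesis by (rule coordinate_step_nonzero[OF \<Omega>(1) a p(2,3,4) \<delta> \<epsilon> False])
      qed
    qed
    from lower_semicontinuous_by_coordinates[where J = UNIV and p = p and a = a, OF this _ \<open>\<epsilon> > 0\<close>] show ?thesis by simp
  qed
  have "continuous_on \<Omega> p"
    unfolding continuous_on_def
  proof (intro ballI order_tendstoI)
    fix a y assume a: "a \<in> \<Omega>" and "y < p a"
    \<comment> \<open>Half of the gap is kept so that the lower bound remains strictly above
      \<open>y\<close>.\<close>
    then obtain \<eta> where "\<eta> > 0" "\<And>w. dist w a < \<eta> \<Longrightarrow> p a - (p a - y) / 2 \<le> p w"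
      using lower[OF a, of "(p a - y) / 2"] by auto
    moreover have "y < p a - (p a - y) / 2" using \<open>y < p a\<close> by (simp add: field_simps)
    ultimately show "\<forall>\<^sub>F w in at a within \<Omega>. y < p w"
      unfolding eventually_at by (meson less_le_trans)
  next
    fix a y assume "a \<in> \<Omega>" "p a < y"
    then show "\<forall>\<^sub>F w in at a within \<Omega>. p w < y" using p(2) by (simp add: usc_on_def)
  qed
  then have "continuous_on \<Omega> (\<lambda>z. ereal (p z))" by (rule continuous_on_ereal)
  then show ?thesis by (rule continuous_on_cong[THEN iffD1, rotated -1]) (simp_all add: p(1))
qed

end
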